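(* Let $q$ be a prime power, let $N,D$ be integers with $D\ge 3$, $N\ge 2D$, and set $$k=\sqrt{-1}\,q^{(D-N-1)/2},\qquad k'=\sqrt{-1}\,q^{-D/2},\qquad u=q^{D-\frac N2}.$$ Let $\Gamma=J_q(N,D)$ be the Grassmann graph, $C$ a Delsarte clique of $\Gamma$, $x\in C$, and let $\mathbf W$ be the $2D$-dimensional subspace of $\mathbb C^X$ with ordered basis $\mathcal C=\{\hat C^-_0,\hat C^+_0,\hat C^-_1,\hat C^+_1,\dots,\hat C^-_{D-1},\hat C^+_{D-1}\}$. Then there exists an $\mathcal H_{\mathrm V}(k,k',u;q)$-module structure on $\mathbf W$ such that the matrices representing $\mathcal T,\mathcal T',\mathcal U,\mathcal U'$ with respect to the ordered basis $\mathcal C$ are $\pmb T,\pmb T',\pmb U,\pmb U'$, respectively.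
   Context: Graph notation. $\Gamma=J_q(N,D)$ has as vertex set $X$ all $D$-dimensional subspaces of an $N$-dimensional vector space over $\mathbb F_q$, adjacency meaning intersection of dimension $D-1$; $\partial$ is path-length distance. A Delsarte clique is a clique of size $\frac{q^{N-D+1}-1}{q-1}$ (attaining the Hoffman bound). For $0\le i\le D-1$: $C_i=\{y\in X:\min_{z\in C}\partial(y,z)=i\}$, $C^-_i=\{y\in C_i:\partial(x,y)=i\}$, $C^+_i=\{y\in C_i:\partial(x,y)=i+1\}$ (all nonempty, partitioning $X$). $\hat Y\in\mathbb C^X$ is the characteristic vector of $Y\subseteq X$. Algebra. For nonzero scalars $k,k',u,q\in\mathbb C$ (with a fixed $q^{1/2}$; positive here), the confluent Cherednik algebra $\mathcal H_{\mathrm V}(k,k',u;q)$ is the associative unital $\mathbb C$-algebra with generators $\mathcal T,\mathcal T',\mathcal U,\mathcal U'$ and relations $$(\mathcal T-k)(\mathcal T+k^{-1})=0,\quad \mathcal U'(\mathcal U'+1)=0,\quad(\mathcal T'-k')(\mathcal T'+k'^{-1})=0,\quad \mathcal U(\mathcal U+u^{-1})=0,$$ $$q^{1/2}\mathcal T'\mathcal T\mathcal U'=\mathcal U+u^{-1},\qquad q^{1/2}\mathcal U\mathcal T'\mathcal T=\mathcal U'+1.$$ Matrices. For $0\le i\le D-1$, $$t(i)=k\begin{bmatrix}1-q^{i+1}+q^{N-D+1}& q^{N-D+1}(q^{D-N+i}-1)\\ 1-q^{i+1}&q^{i+1}\end{bmatrix},\qquad u'(i)=\begin{bmatrix}-1&0\\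 q^{-i-1}-1&0\end{bmatrix};$$ for $1\le i\le D-1$, $$t'(i)=k'\begin{bmatrix}1-q^i+q^D&q^i-q^D\\1-q^i&q^i\end{bmatrix},\qquad u(i)=u^{-1}\begin{bmatrix}-1&1-q^{D-i}\\0&0\end{bmatrix};$$ and the $1\times1$ matrices $t'(0)=t'(D)=[k']$, $u(0)=[0]$, $u(D)=[-u^{-1}]$. Then $\pmb T=\mathrm{blockdiag}[t(0),\dots,t(D-1)]$, $\pmb U'=\mathrm{blockdiag}[u'(0),\dots,u'(D-1)]$, $\pmb T'=\mathrm{blockdiag}[t'(0),t'(1),\dots,t'(D)]$, $\pmb U=\mathrm{blockdiag}[u(0),u(1),\dots,u(D)]$, all in $\mathbb C^{2D\times2D}$. Convention: the $j$-th column of the matrix representing an operator holds the coordinates of the image of the $j$-th basis vector. *)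

theory Defs
  imports
    "HOL-Analysis.Analysis"
    "HOL-Library.Function_Algebras"
    "HOL-Library.Poly_Mapping"
    "HOL-Algebra.QuotRing"
    "Jordan_Normal_Form.Matrix"
begin

subsection \<open>Free complex algebras\<close>

text \<open>
  The free associative unital algebra on \<open>'g\<close> is the monoid algebra of the free monoid of words
  in \<open>'g\<close>.  The monoid is written additively (addition is concatenation, not commutative) because
  multiplication of \<^typ>\<open>'a \<Rightarrow>\<^sub>0 complex\<close> is convolution with respect to addition on \<open>'a\<close>.
\<close>

datatype 'g word = Word (letters: "'g list")

instantiation word :: (type) monoid_add
begin

definition "0 = Word []"

definition "v + w = Word (letters v @ letters w)"

instance
  by standard (simp_all add: zero_word_def plus_word_def)

end

type_synonym 'g free_alg = "'g word \<Rightarrow>\<^sub>0 complex"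

definition free_gen :: "'g \<Rightarrow> 'g free_alg" where
  "free_gen g = Poly_Mapping.single (Word [g]) 1"

definition free_const :: "complex \<Rightarrow> 'g free_alg" where
  "free_const c = Poly_Mapping.single 0 c"

definition free_alg_ring :: "'g free_alg ring" where
  "free_alg_ring = \<lparr>carrier = UNIV, mult = (*), one = 1, zero = 0, add = (+)\<rparr>"

subsection \<open>The confluent Cherednik algebra\<close>

datatype hv_generator = Gen_T | Gen_T' | Gen_U | Gen_U'

text \<open>
  The square root of \<open>q\<close> occurring in the relations is the principal one; it is positive
  for positive \<open>q\<close>.
\<close>

definition hv_relators ::
    "complex \<Rightarrow> complex \<Rightarrow> complex \<Rightarrow> complex \<Rightarrow> hv_generator free_alg set" where
  "hv_relators k k' u q =
    {(free_gen Gen_T - free_const k) * (free_gen Gen_T + free_const (inverse k)),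
     free_gen Gen_U' * (free_gen Gen_U' + 1),
     (free_gen Gen_T' - free_const k') * (free_gen Gen_T' + free_const (inverse k')),
     free_gen Gen_U * (free_gen Gen_U + free_const (inverse u)),
     free_const (csqrt q) * free_gen Gen_T' * free_gen Gen_T * free_gen Gen_U'
       - (free_gen Gen_U + free_const (inverse u)),
     free_const (csqrt q) * free_gen Gen_U * free_gen Gen_T' * free_gen Gen_T - (free_gen Gen_U' + 1)}"

definition hv_ideal ::
    "complex \<Rightarrow> complex \<Rightarrow> complex \<Rightarrow> complex \<Rightarrow> hv_generator free_alg set" where
  "hv_ideal k k' u q = Idl\<^bsub>free_alg_ring\<^esub> (hv_relators k k' u q)"

definition HV ::
    "complex \<Rightarrow> complex \<Rightarrow> complex \<Rightarrow> complex \<Rightarrow> hv_generator free_alg set ring" where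
  "HV k k' u q = free_alg_ring Quot (hv_ideal k k' u q)"

definition HV_class ::
    "complex \<Rightarrow> complex \<Rightarrow> complex \<Rightarrow> complex \<Rightarrow> hv_generator free_alg \<Rightarrow> hv_generator free_alg set" where
  "HV_class k k' u q p = hv_ideal k k' u q +>\<^bsub>free_alg_ring\<^esub> p"

definition HV_gen ::
    "complex \<Rightarrow> complex \<Rightarrow> complex \<Rightarrow> complex \<Rightarrow> hv_generator \<Rightarrow> hv_generator free_alg set" where
  "HV_gen k k' u q g = HV_class k k' u q (free_gen g)"

text \<open>The structure map from the complex numbers, which makes the quotient a complex algebra.\<close>

definition HV_const ::
    "complex \<Rightarrow> complex \<Rightarrow> complex \<Rightarrow> complex \<Rightarrow> complex \<Rightarrow> hv_generator free_alg set" where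
  "HV_const k k' u q c = HV_class k k' u q (free_const c)"

subsection \<open>Complex function spaces, modules and representing matrices\<close>

definition fun_scale :: "complex \<Rightarrow> ('p \<Rightarrow> complex) \<Rightarrow> 'p \<Rightarrow> complex" where
  "fun_scale c f = (\<lambda>p. c * f p)"

global_interpretation fun_space: vector_space fun_scale
  by standard (auto simp: fun_scale_def fun_eq_iff algebra_simps)

text \<open>
  \<open>act\<close> makes the complex subspace \<open>W\<close> of a function space a left module over the complex algebra
  given by the ring \<open>A\<close> with structure map \<open>\<eta>\<close>, extending the vector space structure of \<open>W\<close>.
\<close>

locale algebra_module = ring A
  for A :: "('h, 'm) ring_scheme" (structure) +
  fixes \<eta> :: "complex \<Rightarrow> 'h"
    and W :: "('p \<Rightarrow> complex) set"
    and act :: "'h \<Rightarrow> ('p \<Rightarrow> complex) \<Rightarrow> ('p \<Rightarrow> complex)"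
  assumes subspace: "fun_space.subspace W"
    and act_closed: "\<lbrakk>a \<in> carrier A; w \<in> W\<rbrakk> \<Longrightarrow> act a w \<in> W"
    and act_add_right: "\<lbrakk>a \<in> carrier A; v \<in> W; w \<in> W\<rbrakk> \<Longrightarrow> act a (v + w) = act a v + act a w"
    and act_add_left: "\<lbrakk>a \<in> carrier A; b \<in> carrier A; w \<in> W\<rbrakk> \<Longrightarrow> act (a \<oplus> b) w = act a w + act b w"
    and act_mult: "\<lbrakk>a \<in> carrier A; b \<in> carrier A; w \<in> W\<rbrakk> \<Longrightarrow> act (a \<otimes> b) w = act a (act b w)"
    and act_one: "w \<in> W \<Longrightarrow> act \<one> w = w"
    and act_const: "w \<in> W \<Longrightarrow> act (\<eta> c) w = fun_scale c w"

definition ordered_basis :: "('p \<Rightarrow> complex) set \<Rightarrow> ('p \<Rightarrow> complex) list \<Rightarrow> bool" where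
  "ordered_basis W bs \<longleftrightarrow>
    distinct bs \<and> fun_space.independent (set bs) \<and> fun_space.span (set bs) = W"

definition represents ::
    "complex mat \<Rightarrow> ('p \<Rightarrow> complex) list \<Rightarrow> (('p \<Rightarrow> complex) \<Rightarrow> ('p \<Rightarrow> complex)) \<Rightarrow> bool" where
  "represents M bs f \<longleftrightarrow> M \<in> carrier_mat (length bs) (length bs) \<and>
    (\<forall>j<length bs. f (bs ! j) = (\<Sum>i<length bs. fun_scale (M $$ (i, j)) (bs ! i)))"

subsection \<open>The Grassmann graph\<close>

definition graph_dist :: "'a rel \<Rightarrow> 'a \<Rightarrow> 'a \<Rightarrow> nat" where
  "graph_dist E x y = (LEAST n. (x, y) \<in> E ^^ n)"

definition grassmann_verts :: "('f::field \<Rightarrow> 'v::ab_group_add \<Rightarrow> 'v) \<Rightarrow> nat \<Rightarrow> 'v set set" where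
  "grassmann_verts smul D = {Y. module.subspace smul Y \<and> vector_space.dim smul Y = D}"

definition grassmann_adj :: "('f::field \<Rightarrow> 'v::ab_group_add \<Rightarrow> 'v) \<Rightarrow> nat \<Rightarrow> 'v set rel" where
  "grassmann_adj smul D =
    {(Y, Z). Y \<in> grassmann_verts smul D \<and> Z \<in> grassmann_verts smul D \<and>
             vector_space.dim smul (Y \<inter> Z) = D - 1}"

abbreviation grassmann_dist ::
    "('f::field \<Rightarrow> 'v::ab_group_add \<Rightarrow> 'v) \<Rightarrow> nat \<Rightarrow> 'v set \<Rightarrow> 'v set \<Rightarrow> nat" where
  "grassmann_dist smul D \<equiv> graph_dist (grassmann_adj smul D)"

definition grassmann_clique ::
    "('f::field \<Rightarrow> 'v::ab_group_add \<Rightarrow> 'v) \<Rightarrow> nat \<Rightarrow> 'v set set \<Rightarrow> bool" where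
  "grassmann_clique smul D C \<longleftrightarrow> C \<subseteq> grassmann_verts smul D \<and>
    (\<forall>Y\<in>C. \<forall>Z\<in>C. Y \<noteq> Z \<longrightarrow> (Y, Z) \<in> grassmann_adj smul D)"

definition delsarte_clique ::
    "('f::{field,finite} \<Rightarrow> 'v::ab_group_add \<Rightarrow> 'v) \<Rightarrow> nat \<Rightarrow> 'v set set \<Rightarrow> bool" where
  "delsarte_clique smul D C \<longleftrightarrow> grassmann_clique smul D C \<and>
    real (card C) =
      (real CARD('f) ^ (vector_space.dim smul (UNIV :: 'v set) - D + 1) - 1) / (real CARD('f) - 1)"

definition clique_cell ::
    "('f::field \<Rightarrow> 'v::ab_group_add \<Rightarrow> 'v) \<Rightarrow> nat \<Rightarrow> 'v set set \<Rightarrow> nat \<Rightarrow> 'v set set" where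
  "clique_cell smul D C i =
    {y \<in> grassmann_verts smul D. Min (grassmann_dist smul D y ` C) = i}"

definition clique_cell_minus ::
    "('f::field \<Rightarrow> 'v::ab_group_add \<Rightarrow> 'v) \<Rightarrow> nat \<Rightarrow> 'v set set \<Rightarrow> 'v set \<Rightarrow> nat \<Rightarrow> 'v set set" where
  "clique_cell_minus smul D C x i =
    {y \<in> clique_cell smul D C i. grassmann_dist smul D x y = i}"

definition clique_cell_plus ::
    "('f::field \<Rightarrow> 'v::ab_group_add \<Rightarrow> 'v) \<Rightarrow> nat \<Rightarrow> 'v set set \<Rightarrow> 'v set \<Rightarrow> nat \<Rightarrow> 'v set set" where
  "clique_cell_plus smul D C x i =
    {y \<in> clique_cell smul D C i. grassmann_dist smul D x y = i + 1}"

text \<open>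
  Vectors indexed by the vertex set are functions on all sets of vectors that vanish
  outside the vertex set; the characteristic vectors below are of this kind.
\<close>

definition cell_vectors ::
    "('f::field \<Rightarrow> 'v::ab_group_add \<Rightarrow> 'v) \<Rightarrow> nat \<Rightarrow> 'v set set \<Rightarrow> 'v set \<Rightarrow> ('v set \<Rightarrow> complex) list" where
  "cell_vectors smul D C x =
    concat (map (\<lambda>i. [indicator (clique_cell_minus smul D C x i),
                      indicator (clique_cell_plus smul D C x i)]) [0..<D])"

subsection \<open>The representing matrices\<close>

text \<open>
  Exponents that involve a difference are integers, since natural number subtraction truncates.
\<close>

definition t_block :: "complex \<Rightarrow> nat \<Rightarrow> nat \<Rightarrow> complex \<Rightarrow> nat \<Rightarrow> complex mat" where
  "t_block q N D k i = k \<cdot>\<^sub>m mat_of_rows_list 2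
    [[1 - q ^ (i + 1) + q powi (int N - int D + 1),
      q powi (int N - int D + 1) * (q powi (int D - int N + int i) - 1)],
     [1 - q ^ (i + 1), q ^ (i + 1)]]"

definition u'_block :: "complex \<Rightarrow> nat \<Rightarrow> complex mat" where
  "u'_block q i = mat_of_rows_list 2
    [[-1, 0],
     [q powi (- int i - 1) - 1, 0]]"

definition t'_block :: "complex \<Rightarrow> nat \<Rightarrow> complex \<Rightarrow> nat \<Rightarrow> complex mat" where
  "t'_block q D k' i =
    (if i = 0 \<or> i = D then mat_of_rows_list 1 [[k']]
     else k' \<cdot>\<^sub>m mat_of_rows_list 2
       [[1 - q ^ i + q ^ D, q ^ i - q ^ D],
        [1 - q ^ i, q ^ i]])"

definition u_block :: "complex \<Rightarrow> nat \<Rightarrow> complex \<Rightarrow> nat \<Rightarrow> complex mat" where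
  "u_block q D u i =
    (if i = 0 then mat_of_rows_list 1 [[0]]
     else if i = D then mat_of_rows_list 1 [[- inverse u]]
     else inverse u \<cdot>\<^sub>m mat_of_rows_list 2
       [[-1, 1 - q powi (int D - int i)],
        [0, 0]])"

definition T_mat :: "complex \<Rightarrow> nat \<Rightarrow> nat \<Rightarrow> complex \<Rightarrow> complex mat" where
  "T_mat q N D k = diag_block_mat (map (t_block q N D k) [0..<D])"

definition U'_mat :: "complex \<Rightarrow> nat \<Rightarrow> complex mat" where
  "U'_mat q D = diag_block_mat (map (u'_block q) [0..<D])"

definition T'_mat :: "complex \<Rightarrow> nat \<Rightarrow> complex \<Rightarrow> complex mat" where
  "T'_mat q D k' = diag_block_mat (map (t'_block q D k') [0..<D + 1])"

definition U_mat :: "complex \<Rightarrow> nat \<Rightarrow> complex \<Rightarrow> complex mat" where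
  "U_mat q D u = diag_block_mat (map (u_block q D u) [0..<D + 1])"

end

theory Submission
  imports Defs
begin

text \<open>
  The distance in the Grassmann graph is \<open>D - dim (Y \<inter> Z)\<close>, and a clique either has all its members
  above \<open>X \<inter> Z\<close> or all its members inside \<open>X + Z\<close>, for any two distinct members \<open>X\<close>, \<open>Z\<close>.
  In both cases, a \<open>D\<close>-dimensional subspace spanned by part of a basis adapted to \<open>X\<close> and \<open>Z\<close> shows that no cell is
  empty; the cells being disjoint, their characteristic vectors form a basis.  The module is the
  evaluation of noncommutative polynomials at the operators given by the four matrices; it factors
  through the quotient because the defining relators vanish on each basis vector.  That is a
  computation with two consecutive \<open>2 \<times> 2\<close> blocks, which uses only
  \<open>k\<^sup>2 P = k'\<^sup>2 R = -1\<close>, \<open>q\<^sup>1\<^sup>/\<^sup>2 k k' P = - q / u\<close> and \<open>q\<^sup>1\<^sup>/\<^sup>2 k k' R = - u\<close>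
  for \<open>P = q\<^sup>N\<^sup>-\<^sup>D\<^sup>+\<^sup>1\<close> and \<open>R = q\<^sup>D\<close>.
\<close>

subsection \<open>Cliques of the Grassmann graph\<close>

context finite_dimensional_vector_space
begin

section \<open>Dimensions of sums and intersections of subspaces\<close>

text \<open>The dimension formula for sums matches inclusion-exclusion for cardinalities. Subspaces
  spanned by parts of one basis are thus intersected by counting.\<close>

lemma dim_span_Int_independent:
  assumes "independent (A \<union> B)"
  shows "dim (span A \<inter> span B) = card (A \<inter> B)"
proof -
  have fin: "finite A" "finite B"
    using finiteI_independent[OF assms] by auto
  have indep: "independent A" "independent B"
    by (simp_all add: independent_mono[OF assms])
  have "dim (span (A \<union> B)) + dim (span A \<inter> span B) = dim (span A) + dim (span B)"
    unfolding span_Un by (rule dim_sums_Int) simp_all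
  then have "card (A \<union> B) + dim (span A \<inter> span B) = card A + card B"
    by (simp only: indep[THEN dim_span_eq_card_independent] assms[THEN dim_span_eq_card_independent])
  then show ?thesis
    using card_Un_Int[OF fin] by linarith
qed

lemma dim_Int_add_le:
  assumes "subspace S" "subspace T" "subspace Y" "S \<subseteq> Y" "T \<subseteq> Y"
  shows "dim S + dim T \<le> dim Y + dim (S \<inter> T)"
proof -
  have "{s + t |s t. s \<in> S \<and> t \<in> T} \<subseteq> Y"
    using assms by (auto intro: subspace_add)
  then have "dim {s + t |s t. s \<in> S \<and> t \<in> T} \<le> dim Y"
    by (rule dim_subset)
  then show ?thesis
    using dim_sums_Int[OF assms(1,2)] by linarith
qed

text \<open>The equality case of \<open>dim_Int_add_le\<close>: the sum of \<open>S\<close> and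
  \<open>T\<close> lies in \<open>Y\<close> and has at least its dimension.\<close>

lemma subset_span_Un_if_dim_le:
  assumes "subspace S" "subspace T" "subspace Y" "S \<subseteq> Y" "T \<subseteq> Y"
    and "dim Y + dim (S \<inter> T) \<le> dim S + dim T"
  shows "Y \<subseteq> span (S \<union> T)"
proof -
  have span_eq: "span S = S" "span T = T"
    using assms by simp_all
  have "dim (span (S \<union> T)) + dim (S \<inter> T) = dim S + dim T"
    using dim_sums_Int[OF assms(1,2)] by (simp add: span_Un span_eq del: dim_span)
  moreover have "span (S \<union> T) \<subseteq> Y"
    using assms by (intro span_minimal) auto
  ultimately have "span (S \<union> T) = Y"
    using assms by (intro subspace_dim_equal) auto
  then show ?thesis by simp
qed

text \<open>For subspaces of dimension \<open>D\<close> this is the triangle inequality for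
  \<open>D - dim (X \<inter> Y)\<close>. It holds because \<open>X \<inter> Y\<close> and
  \<open>Y \<inter> Z\<close> both lie in \<open>Y\<close>.\<close>

lemma dim_Int_triangle:
  assumes "subspace X" "subspace Y" "subspace Z"
  shows "dim (X \<inter> Y) + dim (Y \<inter> Z) \<le> dim Y + dim (X \<inter> Z)"
proof -
  have "dim (X \<inter> Y) + dim (Y \<inter> Z) \<le> dim Y + dim ((X \<inter> Y) \<inter> (Y \<inter> Z))"
    using assms by (intro dim_Int_add_le) (auto intro: subspace_inter)
  also have "dim ((X \<inter> Y) \<inter> (Y \<inter> Z)) \<le> dim (X \<inter> Z)"
    by (rule dim_subset) auto
  finally show ?thesis by simp
qed

section \<open>Distance in the Grassmann graph\<close>

lemma grassmann_vertsD:
  assumes "Y \<in> grassmann_verts scale D"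
  shows "subspace Y" "dim Y = D"
  using assms by (auto simp: grassmann_verts_def)

text \<open>Lower bound on the distance: by \<open>dim_Int_triangle\<close>, each edge of a walk
  from \<open>X\<close> loses at most one dimension of the intersection with
  \<open>X\<close>.\<close>

lemma dim_Int_ge_if_relpow:
  assumes "(X, Y) \<in> grassmann_adj scale D ^^ n" "X \<in> grassmann_verts scale D" "0 < D"
  shows "D \<le> dim (X \<inter> Y) + n \<and> Y \<in> grassmann_verts scale D"
  using assms(1)
proof (induction n arbitrary: Y)
  case 0
  then show ?case using assms grassmann_vertsD by auto
next
  case (Suc n)
  then obtain Z where Z: "(X, Z) \<in> grassmann_adj scale D ^^ n" "(Z, Y) \<in> grassmann_adj scale D"
    by auto
  then have IH: "D \<le> dim (X \<inter> Z) + n" "Z \<in> grassmann_verts scale D"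
    using Suc.IH by auto
  have Y: "Y \<in> grassmann_verts scale D" "dim (Z \<inter> Y) = D - 1"
    using Z by (auto simp: grassmann_adj_def)
  show ?case
    using dim_Int_triangle[OF grassmann_vertsD(1)[OF assms(2)] grassmann_vertsD(1)[OF IH(2)]
        grassmann_vertsD(1)[OF Y(1)]] grassmann_vertsD(2)[OF IH(2)] IH(1) Y assms(3) by simp
qed

text \<open>Upper bound on the distance, by a walk whose first edge leads to a vertex meeting
  \<open>Y\<close> in one dimension more. Since the start of the walk moves, \<open>X\<close> is
  arbitrary in the induction.\<close>

lemma relpow_if_dim_Int:
  assumes "X \<in> grassmann_verts scale D" "Y \<in> grassmann_verts scale D" "D = dim (X \<inter> Y) + n"
  shows "(X, Y) \<in> grassmann_adj scale D ^^ n"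
  using assms
proof (induction n arbitrary: X)
  case 0
  note X = grassmann_vertsD[OF 0(1)] and Y = grassmann_vertsD[OF 0(2)]
  have "X \<inter> Y = X" "X \<inter> Y = Y"
    using X Y 0 by (intro subspace_dim_equal subspace_inter; simp)+
  then show ?case by auto
next
  case (Suc n)
  note X = grassmann_vertsD[OF Suc.prems(1)] and Y = grassmann_vertsD[OF Suc.prems(2)]
  obtain I where I: "I \<subseteq> X \<inter> Y" "independent I" "X \<inter> Y \<subseteq> span I" "card I = dim (X \<inter> Y)"
    using basis_exists by blast
  obtain A where A: "I \<subseteq> A" "A \<subseteq> X" "independent A" "X \<subseteq> span A"
    using maximal_independent_subset_extend[of I X] I by auto
  have spanA: "span A = X"
    using A X(1) by (metis span_subspace)
  have cardA: "card A = D"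
    using A X basis_card_eq_dim by metis
  have finA: "finite A"
    using A finiteI_independent by blast
  have "I \<noteq> A"
    using I cardA Suc.prems(3) by auto
  then obtain a where a: "a \<in> A" "a \<notin> I"
    using A by blast
  obtain v where v: "v \<in> Y" "v \<notin> X"
  proof (rule ccontr)
    assume "\<not> thesis"
    then have "X \<inter> Y = Y" using that by blast
    then show False using Suc.prems(3) Y by simp
  qed
  \<comment> \<open>Exchanging a basis vector of \<open>X\<close> outside \<open>Y\<close> for a vector of \<open>Y\<close> brings \<open>X\<close> one step closer to \<open>Y\<close>.\<close>
  define X' where "X' = span (insert v (A - {a}))"
  have indep: "independent (insert v A)"
    using v by (intro independent_insertI A(3)) (simp add: spanA)
  then have indep': "independent (insert v (A - {a}))"
    by (rule independent_mono) auto
  have v_notin: "v \<notin> A"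
    using v A by auto
  have "card (insert v (A - {a})) = D"
    using cardA finA a v_notin card_Suc_Diff1[of A a] by simp
  then have dimX': "dim X' = D"
    by (simp only: X'_def dim_span_eq_card_independent[OF indep'])
  then have X': "X' \<in> grassmann_verts scale D"
    by (simp add: grassmann_verts_def X'_def)
  have "A \<inter> insert v (A - {a}) = A - {a}" "A \<union> insert v (A - {a}) = insert v A"
    using a v_notin by auto
  then have XX': "dim (X \<inter> X') = D - 1"
    using dim_span_Int_independent[of A "insert v (A - {a})"] indep cardA finA a
    by (simp add: X'_def spanA)
  then have adj: "(X, X') \<in> grassmann_adj scale D"
    using Suc.prems X' by (simp add: grassmann_adj_def)
  have subX': "subspace X'"
    by (simp add: X'_def)
  \<comment> \<open>The triangle inequality bounds the gain in dimension by one; the independent set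
    \<open>insert v I\<close> below attains it.\<close>
  have "dim (X \<inter> X') + dim (X' \<inter> Y) \<le> dim X' + dim (X \<inter> Y)"
    using dim_Int_triangle X(1) Y(1) subX' by blast
  then have le: "dim (X' \<inter> Y) \<le> Suc (dim (X \<inter> Y))"
    using XX' dimX' Suc.prems(3) by linarith
  have "insert v I \<subseteq> X' \<inter> Y"
    using v I A a by (auto simp: X'_def intro!: span_base)
  moreover have "independent (insert v I)"
    using indep by (rule independent_mono) (use A in auto)
  ultimately have "card (insert v I) \<le> dim (X' \<inter> Y)"
    by (rule independent_card_le_dim)
  then have "dim (X' \<inter> Y) = Suc (dim (X \<inter> Y))"
    using le I finA A v_notin by (metis card_insert_disjoint finite_subset le_antisym subsetD)
  then have "(X', Y) \<in> grassmann_adj scale D ^^ n"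
    using Suc.IH[OF X' Suc.prems(2)] Suc.prems(3) by simp
  then show ?case
    using adj relpow_Suc_I2 by fast
qed

lemma grassmann_dist_eq:
  assumes "X \<in> grassmann_verts scale D" "Y \<in> grassmann_verts scale D" "0 < D"
  shows "grassmann_dist scale D X Y = D - dim (X \<inter> Y)"
  unfolding graph_dist_def
proof (rule Least_equality)
  have "dim (X \<inter> Y) \<le> D"
    using dim_subset[of "X \<inter> Y" X] assms(1) by (auto dest!: grassmann_vertsD)
  then show "(X, Y) \<in> grassmann_adj scale D ^^ (D - dim (X \<inter> Y))"
    using assms by (intro relpow_if_dim_Int) auto
  show "D - dim (X \<inter> Y) \<le> n" if "(X, Y) \<in> grassmann_adj scale D ^^ n" for n
    using dim_Int_ge_if_relpow[OF that] assms by auto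
qed

section \<open>Structure of cliques and nonempty cells\<close>

lemma grassmann_cliqueD:
  assumes "grassmann_clique scale D C" "X \<in> C" "Y \<in> C"
  shows "subspace X" "dim X = D" "X \<noteq> Y \<Longrightarrow> dim (X \<inter> Y) = D - 1"
  using assms by (auto simp: grassmann_clique_def grassmann_adj_def grassmann_verts_def)

text \<open>A member not above \<open>X \<inter> Z\<close> is spanned by its intersections with
  \<open>X\<close> and \<open>Z\<close>. Once such a member \<open>Y'\<close> exists, every member
  \<open>Y\<close> above \<open>X \<inter> Z\<close> is spanned by \<open>X \<inter> Z\<close> and
  \<open>Y \<inter> Y'\<close>, so all members lie in the span of \<open>X\<close> and
  \<open>Z\<close>.\<close>

lemma grassmann_clique_cases:
  assumes C: "grassmann_clique scale D C" and XZ: "X \<in> C" "Z \<in> C" "X \<noteq> Z" and "0 < D"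
  obtains "\<And>Y. Y \<in> C \<Longrightarrow> X \<inter> Z \<subseteq> Y" | "\<And>Y. Y \<in> C \<Longrightarrow> Y \<subseteq> span (X \<union> Z)"
proof (cases "\<forall>Y\<in>C. X \<inter> Z \<subseteq> Y")
  case True
  then show ?thesis using that by blast
next
  case False
  note CD = grassmann_cliqueD[OF C]
  have subs: "\<And>Y. Y \<in> C \<Longrightarrow> subspace Y"
    using CD(1) by blast
  have dimXZ: "dim (X \<inter> Z) = D - 1" and subXZ: "subspace (X \<inter> Z)"
    using CD XZ by (auto intro: subspace_inter)
  have less: "dim (Y \<inter> (X \<inter> Z)) < D - 1" if "subspace Y" "\<not> X \<inter> Z \<subseteq> Y" for Y
  proof (rule ccontr)
    assume "\<not> ?thesis"
    then have "Y \<inter> (X \<inter> Z) = X \<inter> Z"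
      using that subXZ dimXZ by (intro subspace_dim_equal) (auto intro: subspace_inter)
    then show False using that by blast
  qed
  have within: "Y \<subseteq> span (X \<union> Z)" if Y: "Y \<in> C" "\<not> X \<inter> Z \<subseteq> Y" for Y
  proof -
    have "Y \<noteq> X" "Y \<noteq> Z"
      using Y by auto
    then have dims: "dim (Y \<inter> X) = D - 1" "dim (Y \<inter> Z) = D - 1" "dim Y = D"
      using CD Y XZ by blast+
    \<comment> \<open>Two hyperplanes of \<open>Y\<close> whose intersection has dimension below
      \<open>D - 1\<close> span \<open>Y\<close>.\<close>
    have "(Y \<inter> X) \<inter> (Y \<inter> Z) = Y \<inter> (X \<inter> Z)"
      by auto
    then have "Y \<subseteq> span (Y \<inter> X \<union> Y \<inter> Z)"
      using less[of Y] Y subs XZ dims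
      by (intro subset_span_Un_if_dim_le) (auto intro: subspace_inter)
    also have "\<dots> \<subseteq> span (X \<union> Z)"
      by (rule span_mono) auto
    finally show ?thesis .
  qed
  from False obtain Y' where Y': "Y' \<in> C" "\<not> X \<inter> Z \<subseteq> Y'"
    by blast
  have "Y \<subseteq> span (X \<union> Z)" if Y: "Y \<in> C" for Y
  proof (cases "X \<inter> Z \<subseteq> Y")
    case True
    then have dims: "dim (Y \<inter> Y') = D - 1" "dim Y = D"
      using CD Y Y' by blast+
    \<comment> \<open>Again two hyperplanes of \<open>Y\<close>; they differ because
      \<open>Y'\<close> does not contain \<open>X \<inter> Z\<close>.\<close>
    have "(X \<inter> Z) \<inter> (Y \<inter> Y') = Y' \<inter> (X \<inter> Z)"
      using True by auto
    then have "Y \<subseteq> span (X \<inter> Z \<union> Y \<inter> Y')"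
      using less[of Y'] Y' Y subs XZ dims dimXZ True
      by (intro subset_span_Un_if_dim_le) (auto intro: subspace_inter)
    also have "\<dots> \<subseteq> span (X \<union> Z)"
      using within[OF Y'] span_superset[of "X \<union> Z"] by (intro span_minimal) auto
    finally show ?thesis .
  qed (use within Y in blast)
  then show ?thesis using that by blast
qed

text \<open>In terms of distances, \<open>Y\<close> is at distance \<open>i\<close> from
  \<open>X\<close> and \<open>i + 1\<close> from \<open>Z\<close>, and no member of the clique is
  nearer than \<open>i\<close>. It is spanned by one vector \<open>a\<close> of \<open>X\<close>
  outside \<open>Z\<close>, by \<open>D - 1 - i\<close> basis vectors of
  \<open>X \<inter> Z\<close>, and by \<open>i\<close> vectors independent of \<open>X\<close> and
  \<open>Z\<close> together.\<close>

lemma grassmann_clique_vertex_exists: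
  assumes C: "grassmann_clique scale D C" and XZ: "X \<in> C" "Z \<in> C" "X \<noteq> Z"
    and i: "i < D" and le: "2 * D \<le> dim UNIV"
  obtains Y where "Y \<in> grassmann_verts scale D" "dim (X \<inter> Y) = D - i" "dim (Z \<inter> Y) = D - i - 1"
    "\<And>K. K \<in> C \<Longrightarrow> dim (K \<inter> Y) \<le> D - i"
proof -
  note CD = grassmann_cliqueD[OF C]
  have X: "subspace X" "dim X = D" and Z: "subspace Z" "dim Z = D" and XZdim: "dim (X \<inter> Z) = D - 1"
    using CD XZ by blast+
  obtain E where E: "E \<subseteq> X \<inter> Z" "independent E" "X \<inter> Z \<subseteq> span E" "card E = dim (X \<inter> Z)"
    using basis_exists by blast
  have finE: "finite E"
    using E finiteI_independent by blast
  have spanE: "span E = X \<inter> Z"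
    using E X Z by (intro span_subspace subspace_inter)
  \<comment> \<open>As \<open>X \<inter> Z\<close> has dimension \<open>D - 1\<close>, any one
    further vector completes its basis \<open>E\<close> to a basis of \<open>X\<close> or of
    \<open>Z\<close>.\<close>
  have extend: "independent (insert a E) \<and> span (insert a E) = V"
    if V: "subspace V" "dim V = D" "X \<inter> Z \<subseteq> V" "a \<in> V" "a \<notin> X \<inter> Z" for V a
  proof
    show indep: "independent (insert a E)"
      using V E spanE by (intro independent_insertI) auto
    show "span (insert a E) = V"
    proof (rule subspace_dim_equal)
      show "span (insert a E) \<subseteq> V"
        using V E by (intro span_minimal) auto
      have "a \<notin> E" using V E by auto
      then show "dim V \<le> dim (span (insert a E))"
        using V E finE i by (simp only: dim_span_eq_card_independent[OF indep]) (simp add: XZdim)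
    qed (use V in auto)
  qed
  have ex: "\<exists>a. a \<in> V \<and> a \<notin> X \<inter> Z" if "dim V = D" for V
  proof -
    have "\<not> V \<subseteq> X \<inter> Z"
      using dim_subset[of V "X \<inter> Z"] that XZdim i by auto
    then show ?thesis by blast
  qed
  obtain a where a: "a \<in> X" "a \<notin> X \<inter> Z"
    using ex X by blast
  obtain b where b: "b \<in> Z" "b \<notin> X \<inter> Z"
    using ex Z by blast
  have aE: "independent (insert a E)" "span (insert a E) = X"
    using extend[OF X _ a] by auto
  have bE: "span (insert b E) = Z"
    using extend[OF Z _ b] by auto
  have "independent (insert b (insert a E))"
    using b by (intro independent_insertI aE(1)) (simp add: aE(2))
  then obtain B where B: "insert b (insert a E) \<subseteq> B" "independent B" "UNIV \<subseteq> span B"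
    using maximal_independent_subset_extend[OF subset_UNIV] by metis
  have finB: "finite B"
    using B finiteI_independent by blast
  have cardB: "card B = dim UNIV"
    using B basis_card_eq_dim[of B UNIV] by simp
  have notin: "a \<notin> E" "b \<notin> E" "a \<noteq> b"
    using a b E by auto
  have "card (B - insert b (insert a E)) = card B - (D + 1)"
    using notin B finE E i XZdim by (subst card_Diff_subset) auto
  \<comment> \<open>The span of \<open>X\<close> and \<open>Z\<close> takes \<open>D + 1\<close>
    vectors of \<open>B\<close>; by \<open>2 * D \<le> dim UNIV\<close> at least
    \<open>D - 1\<close> others remain.\<close>
  then have "i \<le> card (B - insert b (insert a E))"
    using cardB le i by linarith
  then obtain F where F: "F \<subseteq> B - insert b (insert a E)" "card F = i" "finite F"
    using obtain_subset_with_card_n by metis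
  have "D - 1 - i \<le> card E"
    using E XZdim by simp
  then obtain E' where E': "E' \<subseteq> E" "card E' = D - 1 - i" "finite E'"
    using obtain_subset_with_card_n by metis
  \<comment> \<open>All intersections involved are spans of subsets of \<open>B\<close>, so their dimensions are found by counting.\<close>
  define A where "A = insert a (E' \<union> F)"
  define Y where "Y = span A"
  have AB: "A \<subseteq> B"
    using B F E' by (auto simp: A_def)
  have dim_Int: "dim (span S \<inter> Y) = card (S \<inter> A)" if "S \<subseteq> B" for S
    unfolding Y_def using that AB by (intro dim_span_Int_independent independent_mono[OF B(2)]) auto
  have disj: "a \<notin> E'" "a \<notin> F" "b \<notin> E'" "b \<notin> F" "E' \<inter> F = {}" "E \<inter> F = {}"
    using F E' notin by auto
  have "card A = D"
    using disj F E' i by (simp add: A_def card_Un_disjoint)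
  moreover have "dim Y = card A"
    unfolding Y_def using AB B by (intro dim_span_eq_card_independent independent_mono[OF B(2)])
  ultimately have dimY: "dim Y = D" by simp
  have subY: "subspace Y"
    by (simp add: Y_def)
  have ints: "insert a E \<inter> A = insert a E'" "insert b E \<inter> A = E'" "E \<inter> A = E'"
    "insert b (insert a E) \<inter> A = insert a E'"
    using E' disj notin by (auto simp: A_def)
  have dimXY: "dim (X \<inter> Y) = D - i"
    using dim_Int[of "insert a E"] aE B E' disj i by (simp add: ints)
  have dimZY: "dim (Z \<inter> Y) = D - i - 1"
    using dim_Int[of "insert b E"] bE B E' i by (simp add: ints)
  have dimEY: "dim ((X \<inter> Z) \<inter> Y) = D - i - 1"
    using dim_Int[of E] spanE B E' i by (simp add: ints)
  have "dim (K \<inter> Y) \<le> D - i" if K: "K \<in> C" for K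
    using C XZ order.strict_trans1[OF le0 i]
  proof (cases rule: grassmann_clique_cases)
    case 1
    \<comment> \<open>\<open>X \<inter> Z\<close> is a hyperplane of \<open>K\<close>, so
      \<open>K \<inter> Y\<close> exceeds its part in \<open>X \<inter> Z\<close> by at most one
      dimension.\<close>
    have "dim (Y \<inter> K) + dim (K \<inter> (X \<inter> Z)) \<le> dim K + dim (Y \<inter> (X \<inter> Z))"
      using subY CD(1) K XZ by (intro dim_Int_triangle subspace_inter)
    moreover have "K \<inter> (X \<inter> Z) = X \<inter> Z"
      using 1 K by blast
    ultimately show ?thesis
      using CD(2)[OF K K] dimEY XZdim i by (simp add: Int_commute)
  next
    case 2
    \<comment> \<open>Now \<open>K\<close> lies in the span of \<open>X\<close> and
      \<open>Z\<close>, which meets \<open>Y\<close> in the span of \<open>insert a E'\<close>, of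
      dimension \<open>D - i\<close>.\<close>
    have "X \<union> Z \<subseteq> span (insert b (insert a E))"
      using aE(2) bE span_mono[of "insert a E" "insert b (insert a E)"]
        span_mono[of "insert b E" "insert b (insert a E)"] by blast
    then have "span (X \<union> Z) \<subseteq> span (insert b (insert a E))"
      by (intro span_minimal) auto
    then have "K \<inter> Y \<subseteq> span (insert b (insert a E)) \<inter> Y"
      using 2 K by blast
    then have "dim (K \<inter> Y) \<le> dim (span (insert b (insert a E)) \<inter> Y)"
      by (rule dim_subset)
    also have "\<dots> = D - i"
      using dim_Int[of "insert b (insert a E)"] B E' disj i by (simp add: ints)
    finally show ?thesis .
  qed
  then show ?thesis
    using that[OF _ dimXY dimZY] dimY subY by (simp add: grassmann_verts_def)
qed

lemma grassmann_clique_cells_nonempty: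
  assumes C: "grassmann_clique scale D C" "finite C" and X: "X \<in> C" and two: "1 < card C"
    and i: "i < D" and le: "2 * D \<le> dim UNIV"
  shows "clique_cell_minus scale D C X i \<noteq> {}" "clique_cell_plus scale D C X i \<noteq> {}"
proof -
  have verts: "K \<in> grassmann_verts scale D" if "K \<in> C" for K
    using that C by (auto simp: grassmann_clique_def)
  have cell: "\<exists>Y\<in>clique_cell scale D C i.
      grassmann_dist scale D U Y = i \<and> grassmann_dist scale D V Y = i + 1"
    if UV: "U \<in> C" "V \<in> C" "U \<noteq> V" for U V
  proof -
    obtain Y where Y: "Y \<in> grassmann_verts scale D" "dim (U \<inter> Y) = D - i"
        "dim (V \<inter> Y) = D - i - 1" "\<And>K. K \<in> C \<Longrightarrow> dim (K \<inter> Y) \<le> D - i"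
      using grassmann_clique_vertex_exists[OF C(1) UV i le] by metis
    have dist: "grassmann_dist scale D K Y = D - dim (K \<inter> Y)"
      "grassmann_dist scale D Y K = D - dim (K \<inter> Y)" if "K \<in> C" for K
      using grassmann_dist_eq[of _ D] verts[OF that] Y(1) i by (simp_all add: Int_commute)
    have "Min (grassmann_dist scale D Y ` C) = i"
    proof (rule Min_eqI)
      show "i \<in> grassmann_dist scale D Y ` C"
        using UV dist Y i by (intro image_eqI[of _ _ U]) auto
      show "i \<le> d" if d: "d \<in> grassmann_dist scale D Y ` C" for d
      proof -
        obtain K where "K \<in> C" "d = D - dim (K \<inter> Y)"
          using d dist by auto
        then show ?thesis
          using Y(4)[of K] i by linarith
      qed
    qed (use C in simp)
    then show ?thesis
      using Y dist UV i by (intro bexI[of _ Y]) (auto simp: clique_cell_def)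
  qed
  obtain Z where "Z \<in> C" "Z \<noteq> X"
    using two by (metis X One_nat_def is_singletonI' is_singleton_altdef less_irrefl equals0D)
  \<comment> \<open>With \<open>X\<close> in the role of \<open>U\<close> the vertex is at distance
    \<open>i\<close> from \<open>X\<close>; with \<open>X\<close> in the role of \<open>V\<close> it
    is at distance \<open>i + 1\<close>.\<close>
  then show "clique_cell_minus scale D C X i \<noteq> {}" "clique_cell_plus scale D C X i \<noteq> {}"
    using cell[of X Z] cell[of Z X] X
    by (auto simp: clique_cell_minus_def clique_cell_plus_def)
qed

end

subsection \<open>Modules over presented algebras\<close>

text \<open>
  Simp would otherwise evaluate sums of functions inside eta-expanded terms, after which the
  linearity rules no longer match.
\<close>
declare plus_fun_apply [simp del] zero_fun_apply [simp del]

section \<open>Evaluation of noncommutative polynomials at operators\<close>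

lemma update_eq_add_single:
  assumes "a \<notin> Poly_Mapping.keys p"
  shows "Poly_Mapping.update a c p = p + Poly_Mapping.single a c"
  using assms
  by (intro poly_mapping_eqI)
     (auto simp: lookup_update lookup_add lookup_single in_keys_iff)

lemma poly_mapping_add_single_induct [case_names zero add]:
  assumes "P 0"
    and "\<And>p a c. P p \<Longrightarrow> P (p + Poly_Mapping.single a c)"
  shows "P p"
proof (induction p rule: update_induct)
  case (update p a c)
  then show ?case
    using assms(2) by (simp add: update_eq_add_single)
qed (rule assms(1))

context
  fixes G :: "'g \<Rightarrow> ('p \<Rightarrow> complex) \<Rightarrow> 'p \<Rightarrow> complex"
begin

text \<open>The last letter acts first, so concatenation of words becomes composition of
  operators.\<close>

definition word_op :: "'g word \<Rightarrow> ('p \<Rightarrow> complex) \<Rightarrow> 'p \<Rightarrow> complex" where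
  "word_op w = foldr G (letters w)"

text \<open>The extension of \<open>G\<close> to the free algebra that its universal property
  provides, once the operators are linear.\<close>

definition alg_op :: "'g free_alg \<Rightarrow> ('p \<Rightarrow> complex) \<Rightarrow> 'p \<Rightarrow> complex" where
  "alg_op p f = (\<Sum>w\<in>Poly_Mapping.keys p. fun_scale (Poly_Mapping.lookup p w) (word_op w f))"

lemma word_op_zero: "word_op 0 f = f"
  by (simp add: word_op_def zero_word_def)

lemma word_op_add: "word_op (v + w) f = word_op v (word_op w f)"
  by (simp add: word_op_def plus_word_def)

lemma alg_op_zero: "alg_op 0 f = 0"
  by (simp add: alg_op_def)

lemma alg_op_add: "alg_op (p + r) f = alg_op p f + alg_op r f"
  unfolding alg_op_def
  by (rule setsum_keys_plus_distrib)
     (rule fun_space.scale_zero_left, rule fun_space.scale_left_distrib)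

lemma alg_op_single: "alg_op (Poly_Mapping.single w c) f = fun_scale c (word_op w f)"
  by (simp add: alg_op_def)

lemma alg_op_minus: "alg_op (p - r) f = alg_op p f - alg_op r f"
  using alg_op_add[of "p - r" r f] by simp

lemma alg_op_const: "alg_op (free_const c) f = fun_scale c f"
  by (simp add: free_const_def alg_op_single word_op_zero)

lemma alg_op_gen: "alg_op (free_gen g) f = G g f"
  by (simp add: free_gen_def alg_op_single word_op_def)

lemma alg_op_one: "alg_op 1 f = f"
  using alg_op_const[of 1] by (simp add: free_const_def)

context
  assumes linear: "\<And>g. Vector_Spaces.linear fun_scale fun_scale (G g)"
begin

lemma word_op_linear: "Vector_Spaces.linear fun_scale fun_scale (word_op w)"
proof -
  have "Vector_Spaces.linear fun_scale fun_scale (foldr G gs)" for gs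
  proof (induction gs)
    case Nil
    then show ?case by (simp add: fun_space.linear_id[unfolded id_def] id_def)
  next
    case (Cons g gs)
    then show ?case
      using Vector_Spaces.linear_compose[OF Cons linear] by (simp add: comp_def)
  qed
  then show ?thesis by (simp add: word_op_def[abs_def])
qed

lemma alg_op_linear: "Vector_Spaces.linear fun_scale fun_scale (alg_op p)"
proof -
  interpret pair: vector_space_pair "fun_scale :: complex \<Rightarrow> ('p \<Rightarrow> complex) \<Rightarrow> _"
    "fun_scale :: complex \<Rightarrow> ('p \<Rightarrow> complex) \<Rightarrow> _" ..
  show ?thesis
    unfolding alg_op_def[abs_def]
    by (intro pair.linear_compose_sum ballI pair.linear_compose_scale_right word_op_linear)
qed

lemma alg_op_add_right: "alg_op p (f + h) = alg_op p f + alg_op p h"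
  and alg_op_scale_right: "alg_op p (fun_scale c f) = fun_scale c (alg_op p f)"
  using alg_op_linear[of p] unfolding Vector_Spaces.linear_iff by blast+

lemma alg_op_zero_right: "alg_op p 0 = 0"
  using alg_op_scale_right[of p 0 0] by simp

text \<open>Both sides are additive in each factor, the right side by linearity of the operators, so
  two inductions reduce the claim to a product of monomials.\<close>

lemma alg_op_mult: "alg_op (p * r) f = alg_op p (alg_op r f)"
proof (induction p rule: poly_mapping_add_single_induct)
  case (add p v c)
  have "alg_op (Poly_Mapping.single v c * r) f = fun_scale c (word_op v (alg_op r f))"
  proof (induction r rule: poly_mapping_add_single_induct)
    case zero
    then show ?case
      by (simp only: mult_zero_right alg_op_zero alg_op_zero_right flip: alg_op_single)
  next
    case (add r w d)
    have word_scale: "word_op v (fun_scale d h) = fun_scale d (word_op v h)" 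
      and word_add: "word_op v (h + h') = word_op v h + word_op v h'" for h h'
      using word_op_linear[of v] by (auto simp: Vector_Spaces.linear_iff)
    show ?case
      by (simp add: distrib_left alg_op_add add mult_single alg_op_single word_op_add word_add
          word_scale fun_space.scale_right_distrib)
  qed
  then show ?case
    by (simp add: distrib_right alg_op_add add alg_op_single)
qed (simp add: alg_op_zero)

lemma alg_op_closed:
  assumes "fun_space.subspace W" and "\<And>g f. f \<in> W \<Longrightarrow> G g f \<in> W" and "f \<in> W"
  shows "alg_op p f \<in> W"
proof -
  have "foldr G gs f \<in> W" for gs
    using assms by (induction gs) auto
  then show ?thesis
    unfolding alg_op_def word_op_def
    using assms by (intro fun_space.subspace_sum fun_space.subspace_scale)
qed

end

end

section \<open>The free algebra as a ring, and modules over its quotients\<close>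

lemma ring_free_alg_ring: "ring (free_alg_ring :: 'g free_alg ring)"
proof (rule ringI)
  show "abelian_group (free_alg_ring :: 'g free_alg ring)"
  proof (rule abelian_groupI)
    show "\<exists>y\<in>carrier free_alg_ring. y \<oplus>\<^bsub>free_alg_ring\<^esub> x = \<zero>\<^bsub>free_alg_ring\<^esub>"
      for x :: "'g free_alg"
      by (intro bexI[of _ "- x"]) (simp_all add: free_alg_ring_def)
  qed (simp_all add: free_alg_ring_def ac_simps)
  show "monoid (free_alg_ring :: 'g free_alg ring)"
    by (rule monoidI) (simp_all add: free_alg_ring_def mult.assoc)
qed (simp_all add: free_alg_ring_def distrib_left distrib_right)

lemma free_alg_ring_simps [simp]:
  "carrier free_alg_ring = UNIV"
  "x \<otimes>\<^bsub>free_alg_ring\<^esub> y = x * y"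
  "x \<oplus>\<^bsub>free_alg_ring\<^esub> y = x + y"
  "\<one>\<^bsub>free_alg_ring\<^esub> = 1"
  "\<zero>\<^bsub>free_alg_ring\<^esub> = 0"
  by (simp_all add: free_alg_ring_def)

lemma free_alg_ring_minus: "x \<ominus>\<^bsub>free_alg_ring\<^esub> y = x - y"
proof -
  interpret ring "free_alg_ring :: 'a free_alg ring"
    by (rule ring_free_alg_ring)
  have "(x \<ominus>\<^bsub>free_alg_ring\<^esub> y) + y = x"
    using minus_closed[of x y] a_assoc[of x "\<ominus>\<^bsub>free_alg_ring\<^esub> y" y] l_neg[of y]
    by (simp add: a_minus_def)
  then show ?thesis
    by (simp add: eq_diff_eq)
qed

text \<open>The annihilator absorbs products on the left because the operators fix 0, and on the
  right because they map \<open>W\<close> into itself.\<close>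

lemma annihilator_ideal:
  assumes "\<And>g. Vector_Spaces.linear fun_scale fun_scale (G g)"
    and "fun_space.subspace W" and "\<And>g f. f \<in> W \<Longrightarrow> G g f \<in> W"
  shows "ideal {p. \<forall>f\<in>W. alg_op G p f = 0} free_alg_ring"
proof -
  interpret R: ring "free_alg_ring :: 'a free_alg ring"
    by (rule ring_free_alg_ring)
  let ?I = "{p. \<forall>f\<in>W. alg_op G p f = 0}"
  show ?thesis
  proof (rule idealI)
    show "subgroup ?I (add_monoid free_alg_ring)"
    proof (rule R.add.subgroupI)
      show "\<ominus>\<^bsub>free_alg_ring\<^esub> p \<in> ?I" if "p \<in> ?I" for p
      proof -
        have "\<ominus>\<^bsub>free_alg_ring\<^esub> p = 0 - p"
          using free_alg_ring_minus[of 0 p] by (simp add: a_minus_def)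
        then show ?thesis
          using that by (simp only: mem_Collect_eq alg_op_minus alg_op_zero) simp
      qed
    qed (auto simp: alg_op_add intro!: exI[of _ 0] alg_op_zero)
    show "x \<otimes>\<^bsub>free_alg_ring\<^esub> a \<in> ?I" if "a \<in> ?I" for a x
      using that by (simp add: alg_op_mult alg_op_zero_right assms)
    show "a \<otimes>\<^bsub>free_alg_ring\<^esub> x \<in> ?I" if "a \<in> ?I" for a x
      using that by (simp add: alg_op_mult alg_op_closed assms)
  qed (rule ring_free_alg_ring)
qed

text \<open>The annihilator of \<open>W\<close> is an ideal containing the relators, hence contains
  \<open>I\<close>. Evaluation on \<open>W\<close> is therefore constant on the cosets of
  \<open>I\<close>.\<close>

lemma algebra_module_quotient_exists:
  fixes R :: "'g free_alg set"
  assumes lin: "\<And>g. Vector_Spaces.linear fun_scale fun_scale (G g)"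
    and W: "fun_space.subspace W" "\<And>g f. f \<in> W \<Longrightarrow> G g f \<in> W"
    and rel: "\<And>r f. r \<in> R \<Longrightarrow> f \<in> W \<Longrightarrow> alg_op G r f = 0"
  defines "I \<equiv> Idl\<^bsub>free_alg_ring\<^esub> R"
  shows "\<exists>act. algebra_module (free_alg_ring Quot I) (\<lambda>c. I +>\<^bsub>free_alg_ring\<^esub> free_const c) W act \<and>
    (\<forall>g. \<forall>f\<in>W. act (I +>\<^bsub>free_alg_ring\<^esub> free_gen g) f = G g f)"
proof -
  interpret R: ring "free_alg_ring :: 'g free_alg ring"
    by (rule ring_free_alg_ring)
  let ?cls = "\<lambda>p. I +>\<^bsub>free_alg_ring\<^esub> p"
  interpret ideal I "free_alg_ring :: 'g free_alg ring"
    unfolding I_def by (rule R.genideal_ideal) simp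
  \<comment> \<open>Any representative serves: two of them differ by an element of \<open>I\<close>,
    which kills \<open>W\<close>.\<close>
  define act where "act X f = alg_op G (SOME p. X = ?cls p) f" for X f
  have "I \<subseteq> {p. \<forall>f\<in>W. alg_op G p f = 0}"
    unfolding I_def using rel by (intro R.genideal_minimal annihilator_ideal lin W) auto
  then have act: "act (?cls p) f = alg_op G p f" if "f \<in> W" for p f
  proof -
    have "?cls p = ?cls (SOME p'. ?cls p = ?cls p')"
      by (rule someI) (rule refl)
    then have "p - (SOME p'. ?cls p = ?cls p') \<in> I"
      using R.quotient_eq_iff_same_a_r_cos[OF ideal_axioms] by (simp add: free_alg_ring_minus)
    then have "alg_op G (p - (SOME p'. ?cls p = ?cls p')) f = 0"
      using \<open>I \<subseteq> _\<close> that by blast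
    then show ?thesis
      by (simp add: act_def alg_op_minus)
  qed
  have classes: "\<exists>p. X = ?cls p" if "X \<in> carrier (free_alg_ring Quot I)" for X
    using that by (auto simp: FactRing_def A_RCOSETS_def' a_r_coset_def')
  have add: "?cls p \<oplus>\<^bsub>free_alg_ring Quot I\<^esub> ?cls r = ?cls (p + r)" for p r
    using a_rcos_sum[of p r] by (simp add: FactRing_def)
  have mult: "?cls p \<otimes>\<^bsub>free_alg_ring Quot I\<^esub> ?cls r = ?cls (p * r)" for p r
    using rcoset_mult_add[of p r] by (simp add: FactRing_def)
  have one: "\<one>\<^bsub>free_alg_ring Quot I\<^esub> = ?cls 1"
    by (simp add: FactRing_def)
  have closed: "alg_op G p f \<in> W" if "f \<in> W" for p f
    using alg_op_closed[OF lin W that] .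
  interpret Q: ring "free_alg_ring Quot I"
    by (rule quotient_is_ring)
  have "algebra_module (free_alg_ring Quot I) (\<lambda>c. ?cls (free_const c)) W act"
  proof unfold_locales
    show "fun_space.subspace W" by (rule W)
    fix a b f h
    assume f: "f \<in> W"
    show "act \<one>\<^bsub>free_alg_ring Quot I\<^esub> f = f"
      by (simp add: one act f alg_op_one)
    show "act (?cls (free_const c)) f = fun_scale c f" for c
      by (simp add: act f alg_op_const)
    assume "a \<in> carrier (free_alg_ring Quot I)"
    then obtain p where a: "a = ?cls p" using classes by blast
    show "act a f \<in> W"
      by (simp add: a act f closed)
    show "act a (f + h) = act a f + act a h" if "h \<in> W"
      using that f W by (simp add: a act alg_op_add_right[OF lin] fun_space.subspace_add)
    assume "b \<in> carrier (free_alg_ring Quot I)"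
    then obtain r where b: "b = ?cls r" using classes by blast
    show "act (a \<oplus>\<^bsub>free_alg_ring Quot I\<^esub> b) f = act a f + act b f"
      by (simp add: a b add act f alg_op_add)
    show "act (a \<otimes>\<^bsub>free_alg_ring Quot I\<^esub> b) f = act a (act b f)"
      by (simp add: a b mult act f alg_op_mult[OF lin] closed)
  qed
  then show ?thesis
    by (intro exI[of _ act]) (simp add: act alg_op_gen)
qed

subsection \<open>Operators given by block diagonal matrices\<close>

text \<open>A column through the block \<open>B\<close> vanishes outside the rows of
  \<open>B\<close>. Squareness of the preceding blocks makes row and column offsets agree;
  \<open>g\<close> is arbitrary because dropping the first block shifts the indices.\<close>

lemma sum_diag_block_mat_column:
  fixes g :: "nat \<Rightarrow> 'p \<Rightarrow> complex"
  assumes "\<forall>A\<in>set As. square_mat A" and "square_mat B" and "c < dim_col B"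
  shows "(\<Sum>r<dim_row (diag_block_mat (As @ B # Cs)).
        fun_scale (diag_block_mat (As @ B # Cs) $$ (r, sum_list (map dim_row As) + c)) (g r)) =
    (\<Sum>r<dim_row B. fun_scale (B $$ (r, c)) (g (sum_list (map dim_row As) + r)))"
  using assms
proof (induction As arbitrary: g)
  case Nil
  let ?C = "diag_block_mat Cs"
  have "(\<Sum>r<dim_row B + dim_row ?C. fun_scale (diag_block_mat (B # Cs) $$ (r, c)) (g r)) =
    (\<Sum>r<dim_row B. fun_scale (B $$ (r, c)) (g r))"
  proof (rule sum.mono_neutral_cong_right)
    show "\<forall>r\<in>{..<dim_row B + dim_row ?C} - {..<dim_row B}.
        fun_scale (diag_block_mat (B # Cs) $$ (r, c)) (g r) = 0"
      using Nil by (auto simp: Let_def)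
  qed (use Nil in \<open>auto simp: Let_def\<close>)
  then show ?case by (simp add: Let_def)
next
  case (Cons A As)
  let ?M = "diag_block_mat (As @ B # Cs)" and ?s = "sum_list (map dim_row As)"
  have sq: "dim_col A = dim_row A"
    using Cons.prems by auto
  have "dim_col ?M = sum_list (map dim_col As) + dim_col B + sum_list (map dim_col Cs)"
    by (simp add: dim_diag_block_mat)
  moreover have "map dim_col As = map dim_row As"
    using Cons.prems by auto
  ultimately have c: "?s + c < dim_col ?M"
    using Cons.prems by simp
  have "(\<Sum>r<dim_row A + dim_row ?M.
      fun_scale (diag_block_mat (A # As @ B # Cs) $$ (r, dim_row A + (?s + c))) (g r)) =
    (\<Sum>r\<in>{dim_row A..<dim_row A + dim_row ?M}.
      fun_scale (diag_block_mat (A # As @ B # Cs) $$ (r, dim_row A + (?s + c))) (g r))"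
    using c sq by (intro sum.mono_neutral_right) (auto simp: Let_def)
  also have "\<dots> = (\<Sum>r<dim_row ?M. fun_scale (?M $$ (r, ?s + c)) (g (dim_row A + r)))"
    using c sq
    by (intro sum.reindex_bij_witness[of _ "\<lambda>r. dim_row A + r" "\<lambda>r. r - dim_row A"])
       (auto simp: Let_def)
  also have "\<dots> = (\<Sum>r<dim_row B. fun_scale (B $$ (r, c)) (g (dim_row A + (?s + r))))"
    using Cons.prems by (intro Cons.IH) auto
  finally show ?case
    by (simp add: Let_def add.assoc)
qed

text \<open>The offset is a variable of its own, so that it can be given in closed form such as
  \<open>2*i\<close> or \<open>2*i - 1\<close>.\<close>

lemma represents_diag_block_mat:
  assumes rep: "represents (diag_block_mat (map F [0..<n])) bs f"
    and sq: "\<And>i. i < n \<Longrightarrow> square_mat (F i)"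
    and m: "m < n" and c: "c < dim_col (F m)" and off: "off = (\<Sum>i<m. dim_row (F i))"
  shows "f (bs ! (off + c)) = (\<Sum>r<dim_row (F m). fun_scale (F m $$ (r, c)) (bs ! (off + r)))"
proof -
  have "[0..<n] = [0..<m] @ m # [Suc m..<n]"
    using m upt_add_eq_append[of 0 m "n - m"] by (simp add: upt_conv_Cons)
  then have split: "map F [0..<n] = map F [0..<m] @ F m # map F [Suc m..<n]" (is "_ = ?As @ _ # ?Cs")
    by simp
  have off': "sum_list (map dim_row ?As) = off"
    by (simp add: off comp_def interv_sum_list_conv_sum_set_nat atLeast0LessThan)
  have len: "dim_row (diag_block_mat (map F [0..<n])) = length bs"
    and len': "dim_col (diag_block_mat (map F [0..<n])) = length bs"
    using rep by (auto simp: represents_def)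
  have "map dim_col ?As = map dim_row ?As"
    using sq m by auto
  then have "dim_col (diag_block_mat (?As @ F m # ?Cs)) =
      off + dim_col (F m) + sum_list (map dim_col ?Cs)"
    using off' by (simp only: dim_diag_block_mat map_append list.map sum_list_append sum_list.Cons)
  then have "off + c < length bs"
    using len' c by (simp add: split)
  then have "f (bs ! (off + c)) = (\<Sum>r<dim_row (diag_block_mat (map F [0..<n])).
      fun_scale (diag_block_mat (map F [0..<n]) $$ (r, off + c)) (bs ! r))"
    using rep len by (simp add: represents_def)
  also have "\<dots> = (\<Sum>r<dim_row (F m). fun_scale (F m $$ (r, c)) (bs ! (off + r)))"
    unfolding split off'[symmetric]
    using sq m c by (intro sum_diag_block_mat_column) auto
  finally show ?thesis .
qed

section \<open>Linear operators prescribed on a basis\<close>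

lemma represents_exists:
  assumes "fun_space.independent (set bs)" "distinct bs" "M \<in> carrier_mat (length bs) (length bs)"
  shows "\<exists>f. Vector_Spaces.linear fun_scale fun_scale f \<and> represents M bs f"
proof -
  interpret pair: vector_space_pair "fun_scale :: complex \<Rightarrow> ('a \<Rightarrow> complex) \<Rightarrow> _"
    "fun_scale :: complex \<Rightarrow> ('a \<Rightarrow> complex) \<Rightarrow> _" ..
  \<comment> \<open>The position of a basis vector in \<open>bs\<close>, which is unique by
    distinctness; it turns the list of columns into a function of the vector.\<close>
  let ?idx = "the_inv_into {..<length bs} ((!) bs)"
  obtain f where f: "Vector_Spaces.linear fun_scale fun_scale f"
    "\<forall>b\<in>set bs. f b = (\<Sum>i<length bs. fun_scale (M $$ (i, ?idx b)) (bs ! i))"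
    using pair.linear_independent_extend[OF assms(1),
        of "\<lambda>b. \<Sum>i<length bs. fun_scale (M $$ (i, ?idx b)) (bs ! i)"] by blast
  have "?idx (bs ! j) = j" if "j < length bs" for j
    using that assms(2) by (intro the_inv_into_f_f) (auto simp: inj_on_nth)
  then have "represents M bs f"
    using f assms(3) by (simp add: represents_def)
  then show ?thesis using f by blast
qed

lemma fun_linear_zero:
  assumes "Vector_Spaces.linear fun_scale fun_scale f"
  shows "f 0 = 0"
  using assms by (metis Vector_Spaces.linear_iff add_cancel_right_right)

lemma represents_span_closed:
  assumes f: "Vector_Spaces.linear fun_scale fun_scale f" "represents M bs f"
    and w: "w \<in> fun_space.span (set bs)"
  shows "f w \<in> fun_space.span (set bs)"
  using w
proof (induction rule: fun_space.span_induct_alt)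
  case base
  show ?case
    by (simp add: fun_linear_zero[OF f(1)] fun_space.span_zero)
next
  case (step c b v)
  obtain j where "j < length bs" "b = bs ! j"
    using step(1) by (auto simp: in_set_conv_nth)
  then have "f b = (\<Sum>i<length bs. fun_scale (M $$ (i, j)) (bs ! i))"
    using f(2) by (simp add: represents_def)
  moreover have "\<dots> \<in> fun_space.span (set bs)"
    by (intro fun_space.span_sum fun_space.span_scale fun_space.span_base) simp
  ultimately have "f b \<in> fun_space.span (set bs)"
    by simp
  moreover have "f (fun_scale c b + v) = fun_scale c (f b) + f v"
    using f(1) by (simp add: Vector_Spaces.linear_iff)
  ultimately show ?case
    using step.IH by (simp add: fun_space.span_add fun_space.span_scale)
qed

lemma linear_zero_on_span:
  assumes f: "Vector_Spaces.linear fun_scale fun_scale f"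
    and "\<And>b. b \<in> B \<Longrightarrow> f b = 0" and "w \<in> fun_space.span B"
  shows "f w = 0"
  using assms(3)
proof (induction rule: fun_space.span_induct_alt)
  case base
  show ?case
    by (rule fun_linear_zero[OF f])
next
  case (step c b v)
  moreover have "f (fun_scale c b + v) = fun_scale c (f b) + f v"
    using f(1) by (simp add: Vector_Spaces.linear_iff)
  ultimately show ?case
    using assms(2) by simp
qed

lemma sum_fun_apply: "(\<Sum>i\<in>A. f i) p = (\<Sum>i\<in>A. (f i :: 'p \<Rightarrow> complex) p)"
  by (induction A rule: infinite_finite_induct) (simp_all add: plus_fun_apply zero_fun_apply)

lemma indicator_family_independent:
  assumes disj: "\<And>i j. i < n \<Longrightarrow> j < n \<Longrightarrow> i \<noteq> j \<Longrightarrow> S i \<inter> S j = {}"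
    and nonempty: "\<And>i. i < n \<Longrightarrow> S i \<noteq> {}"
  defines "bs \<equiv> map (\<lambda>i. indicator (S i) :: 'p \<Rightarrow> complex) [0..<n]"
  shows "distinct bs" "fun_space.independent (set bs)"
proof -
  have "\<exists>p. p \<in> S i" if "i < n" for i
    using nonempty[OF that] by blast
  then obtain p where p: "\<And>i. i < n \<Longrightarrow> p i \<in> S i"
    by metis
  \<comment> \<open>At \<open>p i\<close> only the indicator of \<open>S i\<close> survives, so
    evaluation there reads off a single coefficient.\<close>
  have ind: "indicator (S j) (p i) = (if i = j then 1 else 0 :: complex)" if "i < n" "j < n" for i j
    using p[OF that(1)] disj[OF that] by (auto simp: indicator_def)
  have inj: "inj_on (\<lambda>i. indicator (S i) :: 'p \<Rightarrow> complex) {0..<n}"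
  proof (rule inj_onI)
    fix i j assume ij: "i \<in> {0..<n}" "j \<in> {0..<n}"
      and eq: "indicator (S i) = (indicator (S j) :: 'p \<Rightarrow> complex)"
    show "i = j"
      using ind[of i i] ind[of i j] ij eq by (auto split: if_splits)
  qed
  then show "distinct bs"
    by (simp add: bs_def distinct_map)
  show "fun_space.independent (set bs)"
  proof (rule fun_space.independent_if_scalars_zero)
    fix f b
    assume sum: "(\<Sum>b\<in>set bs. fun_scale (f b) b) = 0" and b: "b \<in> set bs"
    then obtain i where i: "i < n" "b = indicator (S i)"
      by (auto simp: bs_def)
    have "0 = (\<Sum>b\<in>set bs. fun_scale (f b) b) (p i)"
      by (simp add: sum zero_fun_apply)
    also have "\<dots> = (\<Sum>j<n. f (indicator (S j)) * indicator (S j) (p i))"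
      using inj
      by (simp add: bs_def sum.reindex fun_scale_def sum_fun_apply atLeast0LessThan) 
    also have "\<dots> = (\<Sum>j<n. if i = j then f (indicator (S j)) else 0)"
      using i ind by (intro sum.cong) auto
    also have "\<dots> = f b"
      using i by simp
    finally show "f b = 0" by simp
  qed simp
qed

section \<open>Block sizes and the action of the four matrices\<close>

lemma represents_diag_block_mat_2:
  assumes rep: "represents (diag_block_mat (map F [0..<n])) bs f"
    and sq: "\<And>i. i < n \<Longrightarrow> square_mat (F i)"
    and m: "m < n" "F m \<in> carrier_mat 2 2" and off: "off = (\<Sum>i<m. dim_row (F i))"
  shows "f (bs ! off) = fun_scale (F m $$ (0, 0)) (bs ! off) + fun_scale (F m $$ (1, 0)) (bs ! (off + 1))"
    and "f (bs ! (off + 1)) =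
      fun_scale (F m $$ (0, 1)) (bs ! off) + fun_scale (F m $$ (1, 1)) (bs ! (off + 1))"
  using represents_diag_block_mat[OF rep sq m(1) _ off, of 0]
    represents_diag_block_mat[OF rep sq m(1) _ off, of 1] m(2)
  by (auto simp: numeral_2_eq_2)

lemma mat_of_rows_list_2:
  "mat_of_rows_list 2 [[a, b], [c, d]] \<in> carrier_mat 2 2"
  "mat_of_rows_list 2 [[a, b], [c, d]] $$ (0, 0) = a"
  "mat_of_rows_list 2 [[a, b], [c, d]] $$ (0, 1) = b"
  "mat_of_rows_list 2 [[a, b], [c, d]] $$ (1, 0) = c"
  "mat_of_rows_list 2 [[a, b], [c, d]] $$ (1, 1) = d"
  "mat_of_rows_list 2 [[a, b], [c, d]] $$ (0, Suc 0) = b"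
  "mat_of_rows_list 2 [[a, b], [c, d]] $$ (Suc 0, 0) = c"
  "mat_of_rows_list 2 [[a, b], [c, d]] $$ (Suc 0, Suc 0) = d"
  by (simp_all add: mat_of_rows_list_def numeral_2_eq_2)

lemma smult_mat_of_rows_list_2:
  "w \<cdot>\<^sub>m mat_of_rows_list 2 [[a, b], [c, d]] =
    mat_of_rows_list 2 [[w * a, w * b], [w * c, w * d]]" for w :: complex
  by (rule eq_matI) (auto simp: mat_of_rows_list_def less_Suc_eq numeral_2_eq_2)

lemma t_block_carrier: "t_block q N D k i \<in> carrier_mat 2 2"
  by (simp add: t_block_def mat_of_rows_list_2)

lemma u'_block_carrier: "u'_block q i \<in> carrier_mat 2 2"
  by (simp add: u'_block_def mat_of_rows_list_2)

lemma t'_block_carrier: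
  "i = 0 \<or> i = D \<Longrightarrow> t'_block q D k' i \<in> carrier_mat 1 1"
  "i \<noteq> 0 \<Longrightarrow> i \<noteq> D \<Longrightarrow> t'_block q D k' i \<in> carrier_mat 2 2"
  by (auto simp: t'_block_def mat_of_rows_list_def numeral_2_eq_2)

lemma u_block_carrier:
  "i = 0 \<or> i = D \<Longrightarrow> u_block q D u i \<in> carrier_mat 1 1"
  "i \<noteq> 0 \<Longrightarrow> i \<noteq> D \<Longrightarrow> u_block q D u i \<in> carrier_mat 2 2"
  by (auto simp: u_block_def mat_of_rows_list_def numeral_2_eq_2)

lemma diag_block_mat_carrier_even:
  assumes "\<And>i. i < n \<Longrightarrow> F i \<in> carrier_mat 2 2"
  shows "diag_block_mat (map F [0..<n]) \<in> carrier_mat (2*n) (2*n)"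
proof -
  have "dim_row (F i) = 2" "dim_col (F i) = 2" if "i < n" for i
    using assms[OF that] by auto
  then have "dim_row (diag_block_mat (map F [0..<n])) = 2 * n"
    and "dim_col (diag_block_mat (map F [0..<n])) = 2 * n"
    by (simp_all add: dim_diag_block_mat comp_def interv_sum_list_conv_sum_set_nat)
  then show ?thesis by blast
qed

text \<open>One block of size 1 is followed by blocks of size 2. Truncated subtraction makes the
  formula correct for \<open>m = 0\<close> too.\<close>

lemma sum_odd_block_sizes:
  fixes F :: "nat \<Rightarrow> 'x mat"
  assumes "F 0 \<in> carrier_mat 1 1" "\<And>i. 0 < i \<Longrightarrow> i < D \<Longrightarrow> F i \<in> carrier_mat 2 2"
    and "m \<le> D"
  shows "(\<Sum>i<m. dim_row (F i)) = 2*m - 1" "(\<Sum>i<m. dim_col (F i)) = 2*m - 1"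
proof -
  have "(\<Sum>i<m. dim_row (F i)) = 2*m - 1 \<and> (\<Sum>i<m. dim_col (F i)) = 2*m - 1"
    using assms(3)
  proof (induction m)
    case (Suc m)
    then show ?case
      using assms(1) assms(2)[of m] by (cases "m = 0") auto
  qed simp
  then show "(\<Sum>i<m. dim_row (F i)) = 2*m - 1" "(\<Sum>i<m. dim_col (F i)) = 2*m - 1"
    by auto
qed

lemma diag_block_mat_carrier_odd:
  assumes "F 0 \<in> carrier_mat 1 1" "\<And>i. 0 < i \<Longrightarrow> i < D \<Longrightarrow> F i \<in> carrier_mat 2 2"
    and "F D \<in> carrier_mat 1 1" "0 < D"
  shows "diag_block_mat (map F [0..<D + 1]) \<in> carrier_mat (2*D) (2*D)"
proof -
  have "dim_row (diag_block_mat (map F [0..<D + 1])) = 2 * D"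
    and "dim_col (diag_block_mat (map F [0..<D + 1])) = 2 * D"
    using assms sum_odd_block_sizes[of F D D, OF assms(1,2)]
    by (simp_all add: dim_diag_block_mat comp_def interv_sum_list_conv_sum_set_nat atLeast0LessThan)
  then show ?thesis by blast
qed

text \<open>
  Indices start at 1, and the value 0 at both ends makes the \<open>1 \<times> 1\<close> corner blocks of \<open>T'\<close> and \<open>U\<close>
  obey the formulas of the \<open>2 \<times> 2\<close> blocks.
\<close>
definition padded_nth :: "('p \<Rightarrow> complex) list \<Rightarrow> nat \<Rightarrow> 'p \<Rightarrow> complex" where
  "padded_nth bs j = (if 1 \<le> j \<and> j \<le> length bs then bs ! (j - 1) else 0)"

lemma T_mat_action:
  assumes rep: "represents (T_mat q N D k) bs f" and i: "i < D" and q: "q \<noteq> 0" and len: "length bs = 2*D"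
  shows "f (padded_nth bs (2*i+1)) =
      fun_scale (k * (1 - q^(i+1) + q powi (int N - int D + 1))) (padded_nth bs (2*i+1))
      + fun_scale (k * (1 - q^(i+1))) (padded_nth bs (2*i+2))"
    and "f (padded_nth bs (2*i+2)) =
      fun_scale (k * (q^(i+1) - q powi (int N - int D + 1))) (padded_nth bs (2*i+1))
      + fun_scale (k * q^(i+1)) (padded_nth bs (2*i+2))"
proof -
  \<comment> \<open>Multiplying out the upper right entry of \<open>t_block\<close> removes the
    exponent involving \<open>D - N\<close>; only \<open>q^(i+1)\<close> and
    \<open>q powi (int N - int D + 1)\<close> remain.\<close>
  have "q powi (int N - int D + 1) * q powi (int D - int N + int i) = q powi (int i + 1)"
    using q by (simp add: add.commute flip: power_int_add)
  also have "\<dots> = q^(i+1)"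
    by (metis of_nat_1 of_nat_add power_int_of_nat)
  finally have *: "q powi (int N - int D + 1) * (q powi (int D - int N + int i) - 1) =
      q^(i+1) - q powi (int N - int D + 1)"
    by (simp add: right_diff_distrib)
  have dims: "dim_row (t_block q N D k j) = 2" "dim_col (t_block q N D k j) = 2" for j
    using t_block_carrier by blast+
  note act = represents_diag_block_mat_2[OF rep[unfolded T_mat_def] _ i t_block_carrier, of "2*i",
      unfolded t_block_def[of _ _ _ _ i] smult_mat_of_rows_list_2 mat_of_rows_list_2 *]
  show "f (padded_nth bs (2*i+1)) =
      fun_scale (k * (1 - q^(i+1) + q powi (int N - int D + 1))) (padded_nth bs (2*i+1))
      + fun_scale (k * (1 - q^(i+1))) (padded_nth bs (2*i+2))"
    using act(1) i len by (simp add: dims padded_nth_def mat_of_rows_list_2 *)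
  show "f (padded_nth bs (2*i+2)) =
      fun_scale (k * (q^(i+1) - q powi (int N - int D + 1))) (padded_nth bs (2*i+1))
      + fun_scale (k * q^(i+1)) (padded_nth bs (2*i+2))"
    using act(2) i len by (simp add: dims padded_nth_def mat_of_rows_list_2 *)
qed

lemma U'_mat_action:
  assumes rep: "represents (U'_mat q D) bs f" and i: "i < D" and len: "length bs = 2*D"
  shows "f (padded_nth bs (2*i+1)) =
      fun_scale (-1) (padded_nth bs (2*i+1)) + fun_scale (1 / q^(i+1) - 1) (padded_nth bs (2*i+2))"
    and "f (padded_nth bs (2*i+2)) = 0"
proof -
  have "- int i - 1 = - int (i + 1)"
    by simp
  then have *: "q powi (- int i - 1) = 1 / q^(i+1)"
    by (simp only: power_int_minus power_int_of_nat inverse_eq_divide)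
  have dims: "dim_row (u'_block q j) = 2" "dim_col (u'_block q j) = 2" for j
    using u'_block_carrier by blast+
  note act = represents_diag_block_mat_2[OF rep[unfolded U'_mat_def] _ i u'_block_carrier, of "2*i"]
  show "f (padded_nth bs (2*i+1)) =
      fun_scale (-1) (padded_nth bs (2*i+1)) + fun_scale (1 / q^(i+1) - 1) (padded_nth bs (2*i+2))"
    using act(1) i len by (simp add: dims padded_nth_def u'_block_def[of _ i] mat_of_rows_list_2 *)
  show "f (padded_nth bs (2*i+2)) = 0"
    using act(2) i len by (simp add: dims padded_nth_def u'_block_def[of _ i] mat_of_rows_list_2)
qed

text \<open>For the cell vectors, these blocks pair the plus vector of cell \<open>i - 1\<close>, at
  index \<open>2*i\<close>, with the minus vector of cell \<open>i\<close>, at index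
  \<open>2*i+1\<close>. At \<open>i = 0\<close> and \<open>i = D\<close> one partner is the zero
  padding; \<open>c 0 = 0\<close> and \<open>b D = 0\<close> keep its image zero.\<close>

lemma odd_blocks_action:
  fixes F :: "nat \<Rightarrow> complex mat"
  assumes rep: "represents (diag_block_mat (map F [0..<D + 1])) bs f"
    and lin: "Vector_Spaces.linear fun_scale fun_scale f"
    and F: "F 0 = mat_of_rows_list 1 [[d 0]]" "F D = mat_of_rows_list 1 [[a D]]"
      "\<And>i. 0 < i \<Longrightarrow> i < D \<Longrightarrow> F i = mat_of_rows_list 2 [[a i, b i], [c i, d i]]"
    and ends: "c 0 = 0" "b D = 0"
    and i: "i \<le> D" and D: "0 < D" and len: "length bs = 2*D"
  shows "f (padded_nth bs (2*i)) =
      fun_scale (a i) (padded_nth bs (2*i)) + fun_scale (c i) (padded_nth bs (2*i+1))" (is ?even)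
    and "f (padded_nth bs (2*i+1)) =
      fun_scale (b i) (padded_nth bs (2*i)) + fun_scale (d i) (padded_nth bs (2*i+1))" (is ?odd)
proof -
  have F0: "F 0 \<in> carrier_mat 1 1" "F 0 $$ (0, 0) = d 0" and FD: "F D \<in> carrier_mat 1 1" "F D $$ (0, 0) = a D"
    using F by (simp_all add: mat_of_rows_list_def)
  have Fi: "F i \<in> carrier_mat 2 2" if "0 < i" "i < D" for i
    using F(3)[OF that] by (simp add: mat_of_rows_list_2)
  have sq: "square_mat (F j)" if "j < D + 1" for j
    using F0 FD Fi[of j] that by (cases "j = 0 \<or> j = D") auto
  note off = sum_odd_block_sizes(1)[of F D, OF F0(1) Fi, symmetric]
  have f0: "f 0 = 0"
    using lin by (rule fun_linear_zero)
  consider "i = 0" | "i = D" "i \<noteq> 0" | "0 < i" "i < D"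
    using i by linarith
  then have "?even \<and> ?odd"
  proof cases
    case 1
    have "f (bs ! 0) = fun_scale (d 0) (bs ! 0)"
      using represents_diag_block_mat[OF rep sq, of 0 0 0] F0 by auto
    then show ?thesis
      using 1 ends f0 D len by (simp add: padded_nth_def)
  next
    case 2
    have "f (bs ! (2*D - 1)) = fun_scale (a D) (bs ! (2*D - 1))"
      using represents_diag_block_mat[OF rep sq, of D 0 "2*D - 1"] FD off[of D] by auto
    then show ?thesis
      using 2 ends f0 D len by (simp add: padded_nth_def)
  next
    case 3
    then have next_idx: "2*i - 1 + 1 = 2*i" and "i < D + 1"
      by auto
    note act = represents_diag_block_mat_2[OF rep sq \<open>i < D + 1\<close> Fi[OF 3] off[OF _ _ i],
        unfolded F(3)[OF 3] mat_of_rows_list_2 next_idx]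
    show ?thesis
      using act 3 len by (simp add: padded_nth_def)
  qed
  then show ?even ?odd by auto
qed

text \<open>The corner blocks fit the general formulas: \<open>1 - q^i\<close> vanishes at
  \<open>i = 0\<close> and \<open>q^i - q^D\<close> at \<open>i = D\<close>, and the remaining entry
  is \<open>k'\<close> in both cases.\<close>

lemma T'_mat_action:
  assumes rep: "represents (T'_mat q D k') bs f"
    and lin: "Vector_Spaces.linear fun_scale fun_scale f"
    and i: "i \<le> D" and D: "0 < D" and len: "length bs = 2*D"
  shows "f (padded_nth bs (2*i)) =
      fun_scale (k' * (1 - q^i + q^D)) (padded_nth bs (2*i))
      + fun_scale (k' * (1 - q^i)) (padded_nth bs (2*i+1))"
    and "f (padded_nth bs (2*i+1)) =
      fun_scale (k' * (q^i - q^D)) (padded_nth bs (2*i)) + fun_scale (k' * q^i) (padded_nth bs (2*i+1))"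
proof -
  note * = odd_blocks_action[OF rep[unfolded T'_mat_def] lin, where i = i
      and a = "\<lambda>i. k' * (1 - q^i + q^D)" and b = "\<lambda>i. k' * (q^i - q^D)"
      and c = "\<lambda>i. k' * (1 - q^i)" and d = "\<lambda>i. k' * q^i", OF _ _ _ _ _ i D len]
  show "f (padded_nth bs (2*i)) =
      fun_scale (k' * (1 - q^i + q^D)) (padded_nth bs (2*i))
      + fun_scale (k' * (1 - q^i)) (padded_nth bs (2*i+1))"
    by (rule *(1)) (simp_all add: t'_block_def smult_mat_of_rows_list_2)
  show "f (padded_nth bs (2*i+1)) =
      fun_scale (k' * (q^i - q^D)) (padded_nth bs (2*i)) + fun_scale (k' * q^i) (padded_nth bs (2*i+1))"
    by (rule *(2)) (simp_all add: t'_block_def smult_mat_of_rows_list_2)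
qed

lemma U_mat_action:
  assumes rep: "represents (U_mat q D u) bs f"
    and lin: "Vector_Spaces.linear fun_scale fun_scale f"
    and i: "i \<le> D" and D: "0 < D" and len: "length bs = 2*D" and q: "q \<noteq> 0"
  shows "f (padded_nth bs (2*i)) = fun_scale (- inverse u) (padded_nth bs (2*i))"
    and "f (padded_nth bs (2*i+1)) = fun_scale (inverse u * (1 - q^D / q^i)) (padded_nth bs (2*i))"
proof -
  have powi: "q powi (int D - int j) = q^D / q^j" for j
    using q by (simp add: power_int_diff)
  note * = odd_blocks_action[OF rep[unfolded U_mat_def] lin, where i = i
      and a = "\<lambda>i. - inverse u" and b = "\<lambda>i. inverse u * (1 - q^D / q^i)"
      and c = "\<lambda>i. 0" and d = "\<lambda>i. 0", OF _ _ _ _ _ i D len]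
  have "f (padded_nth bs (2*i)) =
      fun_scale (- inverse u) (padded_nth bs (2*i)) + fun_scale 0 (padded_nth bs (2*i+1))"
    by (rule *(1)) (use D q in \<open>simp_all add: u_block_def smult_mat_of_rows_list_2 powi\<close>)
  then show "f (padded_nth bs (2*i)) = fun_scale (- inverse u) (padded_nth bs (2*i))"
    by simp
  have "f (padded_nth bs (2*i+1)) = fun_scale (inverse u * (1 - q^D / q^i)) (padded_nth bs (2*i)) +
      fun_scale 0 (padded_nth bs (2*i+1))"
    by (rule *(2)) (use D q in \<open>simp_all add: u_block_def smult_mat_of_rows_list_2 powi\<close>)
  then show "f (padded_nth bs (2*i+1)) = fun_scale (inverse u * (1 - q^D / q^i)) (padded_nth bs (2*i))"
    by simp
qed

subsection \<open>The relations of the confluent Cherednik algebra\<close>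

text \<open>\<open>T\<close> and \<open>U'\<close> preserve the span of \<open>v (2*i+1)\<close> and
  \<open>v (2*i+2)\<close>, while \<open>T'\<close> and \<open>U\<close> link these to
  \<open>v (2*i)\<close> and \<open>v (2*i+3)\<close>. The end values \<open>v 0\<close> and
  \<open>v (2*D+1)\<close> are zero in the application.\<close>

lemma hv_relators_vanish_on_span:
  fixes G :: "hv_generator \<Rightarrow> ('p \<Rightarrow> complex) \<Rightarrow> 'p \<Rightarrow> complex" and v :: "nat \<Rightarrow> 'p \<Rightarrow> complex"
  assumes lin: "\<And>g. Vector_Spaces.linear fun_scale fun_scale (G g)"
    and nz: "q \<noteq> 0" "k \<noteq> 0" "k' \<noteq> 0" "u \<noteq> 0" "P \<noteq> 0" "R \<noteq> 0"
    and scalars: "k\<^sup>2 * P = -1" "k'\<^sup>2 * R = -1"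
      "csqrt q * k * k' * P = - q * inverse u" "csqrt q * k * k' * R = - u"
    and T: "\<And>i. i < D \<Longrightarrow> G Gen_T (v (2*i+1)) =
        fun_scale (k * (1 - q^(i+1) + P)) (v (2*i+1)) + fun_scale (k * (1 - q^(i+1))) (v (2*i+2))"
      "\<And>i. i < D \<Longrightarrow> G Gen_T (v (2*i+2)) =
        fun_scale (k * (q^(i+1) - P)) (v (2*i+1)) + fun_scale (k * q^(i+1)) (v (2*i+2))"
    and U': "\<And>i. i < D \<Longrightarrow> G Gen_U' (v (2*i+1)) =
        fun_scale (-1) (v (2*i+1)) + fun_scale (1 / q^(i+1) - 1) (v (2*i+2))"
      "\<And>i. i < D \<Longrightarrow> G Gen_U' (v (2*i+2)) = 0"
    and T': "\<And>i. i \<le> D \<Longrightarrow> G Gen_T' (v (2*i)) =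
        fun_scale (k' * (1 - q^i + R)) (v (2*i)) + fun_scale (k' * (1 - q^i)) (v (2*i+1))"
      "\<And>i. i \<le> D \<Longrightarrow> G Gen_T' (v (2*i+1)) =
        fun_scale (k' * (q^i - R)) (v (2*i)) + fun_scale (k' * q^i) (v (2*i+1))"
    and U: "\<And>i. i \<le> D \<Longrightarrow> G Gen_U (v (2*i)) = fun_scale (- inverse u) (v (2*i))"
      "\<And>i. i \<le> D \<Longrightarrow> G Gen_U (v (2*i+1)) = fun_scale (inverse u * (1 - R / q^i)) (v (2*i))"
    and r: "r \<in> hv_relators k k' u q" and w: "w \<in> fun_space.span (v ` {1..2*D})"
  shows "alg_op G r w = 0"
  using w
proof (rule linear_zero_on_span[OF alg_op_linear[OF lin], rotated])
  fix b assume "b \<in> v ` {1..2*D}"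
  then obtain j where j: "b = v j" "1 \<le> j" "j \<le> 2*D" by auto
  define i where "i = (j - 1) div 2"
  have i: "i < D" and "j = 2*i+1 \<or> j = 2*i+2"
    using j(2,3) by (auto simp: i_def)
  then have b: "b = v (2*i+1) \<or> b = v (2*i+2)"
    using j by auto
  have add: "G g (f + h) = G g f + G g h" and scale: "G g (fun_scale c f) = fun_scale c (G g f)"
    for g f h c
    using lin[of g] unfolding Vector_Spaces.linear_iff by blast+
  note zero = fun_linear_zero[OF lin]
  define c where "c = q^i"
  have c: "c \<noteq> 0" "q^i = c" "q^(i+1) = q * c"
    using nz by (auto simp: c_def)
  \<comment> \<open>Without inverses of \<open>k\<close> and \<open>k'\<close>, the quadratic
    relations become polynomial identities.\<close>
  have inv: "inverse k = - k * P" "inverse k' = - k' * R"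
    using scalars nz by (simp_all add: field_simps power2_eq_square)
  \<comment> \<open>Two expressions for the same root, one cancelling \<open>k * k' * P\<close> and
    the other \<open>k * k' * R\<close>.\<close>
  have s1: "csqrt q = - q * inverse u / (k * k' * P)" and s2: "csqrt q = - u / (k * k' * R)"
    using scalars nz by (simp_all add: field_simps)
  have iD: "i \<le> D" "i + 1 \<le> D" and idx: "2*(i+1) = 2*i+2" "2*i+2+1 = 2*i+3"
    using i by auto
  note act = T[OF i, unfolded c(2,3)] U'[OF i, unfolded c(2,3)]
    T'[OF iD(1), unfolded c(2,3)] T'[OF iD(2), unfolded idx c(2,3)]
    U[OF iD(1), unfolded c(2,3)] U[OF iD(2), unfolded idx c(2,3)]
  note expand = alg_op_mult[OF lin] alg_op_minus alg_op_add alg_op_const alg_op_gen alg_op_one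
    add scale zero
  note pointwise = fun_eq_iff plus_fun_apply zero_fun_apply fun_scale_def
  from r consider
      "r = (free_gen Gen_T - free_const k) * (free_gen Gen_T + free_const (inverse k))"
    | "r = free_gen Gen_U' * (free_gen Gen_U' + 1)"
    | "r = (free_gen Gen_T' - free_const k') * (free_gen Gen_T' + free_const (inverse k'))"
    | "r = free_gen Gen_U * (free_gen Gen_U + free_const (inverse u))"
    | "r = free_const (csqrt q) * free_gen Gen_T' * free_gen Gen_T * free_gen Gen_U'
           - (free_gen Gen_U + free_const (inverse u))"
    | "r = free_const (csqrt q) * free_gen Gen_U * free_gen Gen_T' * free_gen Gen_T
           - (free_gen Gen_U' + 1)"
    unfolding hv_relators_def by blast
  then show "alg_op G r b = 0"
  proof cases
    case 1
    show ?thesis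
      using b by (elim disjE) (simp_all only: 1 expand act inv, simp_all add: pointwise algebra_simps)
  next
    case 2
    show ?thesis
      using b by (elim disjE) (simp_all only: 2 expand act, simp_all add: pointwise algebra_simps)
  next
    case 3
    show ?thesis
      using b by (elim disjE) (simp_all only: 3 expand act inv, simp_all add: pointwise algebra_simps)
  next
    case 4
    show ?thesis
      using b by (elim disjE) (simp_all only: 4 expand act, simp_all add: pointwise algebra_simps)
  next
    \<comment> \<open>\<open>U'\<close> followed by \<open>T\<close> scales \<open>v (2*i+1)\<close>
      by \<open>- k * P / (q * c)\<close> and kills \<open>v (2*i+2)\<close>, whence the form
      \<open>s1\<close>.\<close>
    case 5
    show ?thesis
      using b nz c(1)
      by (elim disjE) (simp_all only: 5 expand act s1, simp_all add: pointwise field_simps)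
  next
    \<comment> \<open>\<open>T'\<close> followed by \<open>U\<close> kills \<open>v (2*i+1)\<close>
      and scales \<open>v (2*i+2)\<close> by \<open>- inverse u * k' * R / (q * c)\<close>, whence
      the form \<open>s2\<close>.\<close>
    case 6
    show ?thesis
      using b nz c(1)
      by (elim disjE) (simp_all only: 6 expand act s2, simp_all add: pointwise field_simps)
  qed
qed

text \<open>Up to the imaginary unit in \<open>k\<close> and \<open>k'\<close>, all factors are real
  powers of \<open>q\<close>: exponents add, and the two imaginary units in each product give the
  sign.\<close>

lemma hv_scalar_relations:
  fixes q N D :: nat and k k' u :: complex
  assumes q: "0 < q"
    and k: "k = \<i> * of_real (real q powr ((real D - real N - 1) / 2))"
    and k': "k' = \<i> * of_real (real q powr (- real D / 2))"
    and u: "u = of_real (real q powr (real D - real N / 2))"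
  defines "P \<equiv> of_nat q powi (int N - int D + 1)"
  shows "k\<^sup>2 * P = -1" "k'\<^sup>2 * of_nat q ^ D = -1"
    "csqrt (of_nat q) * k * k' * P = - of_nat q * inverse u"
    "csqrt (of_nat q) * k * k' * of_nat q ^ D = - u"
proof -
  define r where "r = real q"
  have r: "0 < r" using q by (simp add: r_def)
  have P: "P = of_real (r powr (real N - real D + 1))"
    using powr_real_of_int'[of r "int N - int D + 1"] r
    by (simp add: P_def r_def)
  have R: "of_nat q ^ D = (of_real (r powr real D) :: complex)"
    using r by (simp add: r_def powr_realpow)
  have s: "csqrt (of_nat q) = of_real (r powr (1/2))"
    using r csqrt_of_real_nonneg[of "real q"] by (simp add: r_def powr_half_sqrt)
  have q': "(of_nat q :: complex) = of_real (r powr 1)"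
    using r by (simp add: r_def)
  have u': "inverse u = of_real (r powr (real N / 2 - real D))"
    using powr_minus[of r "real D - real N / 2"] by (simp add: u r_def)
  have square: "(\<i> * of_real a)\<^sup>2 * of_real b = - complex_of_real (a * a * b)" for a b
    by (simp add: power_mult_distrib) (simp add: power2_eq_square)
  have product: "of_real a * (\<i> * of_real b) * (\<i> * of_real c) * of_real d =
      - complex_of_real (a * b * c * d)" for a b c d
    by (simp add: algebra_simps)
  show "k\<^sup>2 * P = -1" "k'\<^sup>2 * of_nat q ^ D = -1"
    unfolding k k' P R square r_def[symmetric] using r by (simp_all flip: powr_add)
  show "csqrt (of_nat q) * k * k' * P = - of_nat q * inverse u"
    unfolding k k' P R s u' product r_def[symmetric] powr_add[symmetric]
    unfolding q' mult_minus_left of_real_mult[symmetric] powr_add[symmetric]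
    by (simp add: field_simps)
  show "csqrt (of_nat q) * k * k' * of_nat q ^ D = - u"
    unfolding k k' R s u product r_def[symmetric] powr_add[symmetric]
    by (simp add: field_simps)
qed

subsection \<open>The basis of cell vectors\<close>

text \<open>Turns the pairs into one family indexed below \<open>2*n\<close>, as
  \<open>indicator_family_independent\<close> expects.\<close>

lemma concat_pairs_eq_map:
  "concat (map (\<lambda>i. [g i, h i]) [0..<n]) = map (\<lambda>j. if even j then g (j div 2) else h (j div 2)) [0..<2*n]"
  by (induction n) simp_all

lemma cell_vectors_basis:
  fixes smul :: "'f::field \<Rightarrow> 'v::ab_group_add \<Rightarrow> 'v"
  assumes "\<And>i. i < D \<Longrightarrow> clique_cell_minus smul D C x i \<noteq> {} \<and> clique_cell_plus smul D C x i \<noteq> {}"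
  shows "distinct (cell_vectors smul D C x)" "fun_space.independent (set (cell_vectors smul D C x))"
    "length (cell_vectors smul D C x) = 2 * D"
proof -
  define S where "S j = (if even j then clique_cell_minus smul D C x (j div 2)
    else clique_cell_plus smul D C x (j div 2))" for j
  have eq: "cell_vectors smul D C x = map (\<lambda>j. indicator (S j)) [0..<2*D]"
    unfolding cell_vectors_def concat_pairs_eq_map S_def by (intro map_cong) auto
  \<comment> \<open>The index is recovered from the distances of \<open>y\<close> to
    \<open>C\<close> and to \<open>x\<close>, hence the sets \<open>S j\<close> are
    disjoint.\<close>
  have "j = 2 * Min (grassmann_dist smul D y ` C) +
      (grassmann_dist smul D x y - Min (grassmann_dist smul D y ` C))" if "y \<in> S j" for y j
    using that
    by (auto simp: S_def clique_cell_minus_def clique_cell_plus_def clique_cell_def split: if_splits)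
  then have disj: "S i \<inter> S j = {}" if "i \<noteq> j" for i j
    using that by blast
  have nonempty: "S j \<noteq> {}" if "j < 2*D" for j
    using that assms[of "j div 2"] by (auto simp: S_def)
  show "distinct (cell_vectors smul D C x)" "fun_space.independent (set (cell_vectors smul D C x))"
    using indicator_family_independent[of "2*D" S] disj nonempty by (auto simp: eq)
  show "length (cell_vectors smul D C x) = 2 * D"
    by (simp add: eq)
qed

text \<open>Provides the second member of the clique for the cell construction:
  \<open>(q^n - 1) / (q - 1)\<close> exceeds 1 when \<open>q\<close> and \<open>n\<close> are at
  least 2.\<close>

lemma delsarte_clique_card:
  fixes smul :: "'f::{field,finite} \<Rightarrow> 'v::ab_group_add \<Rightarrow> 'v"
  assumes "delsarte_clique smul D C" and D: "D < vector_space.dim smul (UNIV :: 'v set)"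
  shows "1 < card C"
proof -
  let ?q = "real CARD('f)" and ?n = "vector_space.dim smul (UNIV :: 'v set) - D + 1"
  have "card {0, 1 :: 'f} \<le> CARD('f)"
    by (intro card_mono) auto
  then have q: "1 < ?q" by simp
  have "?q ^ 1 < ?q ^ ?n"
    using q D by (intro power_strict_increasing) auto
  then have "1 < (?q ^ ?n - 1) / (?q - 1)"
    using q by (simp add: less_divide_eq)
  also have "\<dots> = real (card C)"
    using assms(1) by (simp add: delsarte_clique_def)
  finally show ?thesis by simp
qed

section \<open>Assembly of the module on the span of the cell vectors\<close>

theorem corollary7p5:
  fixes smul :: "'f::{field,finite} \<Rightarrow> 'v::ab_group_add \<Rightarrow> 'v"
    and q N D :: nat
    and k k' u :: complex
    and C :: "'v set set"
    and x :: "'v set"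
    and bs :: "('v set \<Rightarrow> complex) list"
    and W :: "('v set \<Rightarrow> complex) set"
  assumes "vector_space smul"
    and "CARD('f) = q"
    and "vector_space.dim smul (UNIV :: 'v set) = N"
    and "D \<ge> 3"
    and "N \<ge> 2 * D"
    and "k = \<i> * of_real (real q powr ((real D - real N - 1) / 2))"
    and "k' = \<i> * of_real (real q powr (- real D / 2))"
    and "u = of_real (real q powr (real D - real N / 2))"
    and "delsarte_clique smul D C"
    and "x \<in> C"
    and "bs = cell_vectors smul D C x"
    and "W = fun_space.span (set bs)"
  shows "ordered_basis W bs \<and>
    (\<exists>act. algebra_module (HV k k' u (of_nat q)) (HV_const k k' u (of_nat q)) W act \<and>
       represents (T_mat (of_nat q) N D k) bs (act (HV_gen k k' u (of_nat q) Gen_T)) \<and>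
       represents (T'_mat (of_nat q) D k') bs (act (HV_gen k k' u (of_nat q) Gen_T')) \<and>
       represents (U_mat (of_nat q) D u) bs (act (HV_gen k k' u (of_nat q) Gen_U)) \<and>
       represents (U'_mat (of_nat q) D) bs (act (HV_gen k k' u (of_nat q) Gen_U')))"
proof -
  interpret vector_space smul by fact
  obtain B where B: "independent B" "UNIV \<subseteq> span B" "card B = dim (UNIV :: 'v set)"
    by (rule basis_exists[of "UNIV :: 'v set"]) (rule that)
  \<comment> \<open>An infinite basis would have cardinality 0, but \<open>N\<close> is
    positive.\<close>
  have "finite B"
    using B(3) assms(3-5) by (intro card_ge_0_finite) simp
  then interpret finite_dimensional_vector_space smul B
    using B by unfold_locales auto
  let ?q = "of_nat q :: complex"
  have "0 < q"
    unfolding assms(2)[symmetric] by (rule zero_less_card_finite)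
  then have q: "?q \<noteq> 0" "0 < q"
    by simp_all
  have D: "0 < D" using assms(4) by simp
  have card: "1 < card C"
    using assms(3-5,9) by (intro delsarte_clique_card) auto
  then have "finite C"
    using card_ge_0_finite by force
  then have cells: "clique_cell_minus smul D C x i \<noteq> {} \<and> clique_cell_plus smul D C x i \<noteq> {}"
    if "i < D" for i
    using grassmann_clique_cells_nonempty[of D C x i] that assms(3,5,9,10) card
    by (auto simp: delsarte_clique_def simp del: dim_UNIV)
  have basis: "distinct bs" "fun_space.independent (set bs)" and len: "length bs = 2 * D"
    using cell_vectors_basis[of D smul C x] cells unfolding assms(11) by blast+
  \<comment> \<open>Indexing the matrices by generators lets one choice yield all four operators
    \<open>G\<close>.\<close>
  define M where "M g = (case g of Gen_T \<Rightarrow> T_mat ?q N D k | Gen_T' \<Rightarrow> T'_mat ?q D k'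
    | Gen_U \<Rightarrow> U_mat ?q D u | Gen_U' \<Rightarrow> U'_mat ?q D)" for g
  have "M g \<in> carrier_mat (length bs) (length bs)" for g
    unfolding len M_def T_mat_def T'_mat_def U_mat_def U'_mat_def
    by (cases g; simp only: hv_generator.case)
       (intro diag_block_mat_carrier_even diag_block_mat_carrier_odd t_block_carrier
          u'_block_carrier t'_block_carrier u_block_carrier D; simp)+
  then have "\<forall>g. \<exists>f. Vector_Spaces.linear fun_scale fun_scale f \<and> represents (M g) bs f"
    using represents_exists[OF basis(2,1)] by blast
  then obtain G where lin: "\<And>g. Vector_Spaces.linear fun_scale fun_scale (G g)"
    and rep: "\<And>g. represents (M g) bs (G g)"
    by metis
  note reps = rep[of Gen_T, unfolded M_def hv_generator.case] rep[of Gen_T', unfolded M_def hv_generator.case]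
    rep[of Gen_U, unfolded M_def hv_generator.case] rep[of Gen_U', unfolded M_def hv_generator.case]
  have "set bs = padded_nth bs ` {1..2*D}"
  proof (intro equalityI subsetI)
    fix b assume "b \<in> set bs"
    then obtain j where "j < 2*D" "b = bs ! j"
      by (auto simp: in_set_conv_nth len)
    then show "b \<in> padded_nth bs ` {1..2*D}"
      by (intro image_eqI[of _ _ "j + 1"]) (auto simp: padded_nth_def len)
  qed (auto simp: padded_nth_def len)
  then have W: "W = fun_space.span (padded_nth bs ` {1..2*D})"
    using assms(12) by simp
  have nz: "k \<noteq> 0" "k' \<noteq> 0" "u \<noteq> 0" "?q powi (int N - int D + 1) \<noteq> 0" "?q ^ D \<noteq> 0"
    using q assms(6-8) by auto
  \<comment> \<open>Here \<open>P\<close> is \<open>?q powi (int N - int D + 1)\<close> and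
    \<open>R\<close> is \<open>?q ^ D\<close>, as fixed by \<open>nz\<close>.\<close>
  have rel: "alg_op G r w = 0" if "r \<in> hv_relators k k' u ?q" "w \<in> W" for r w
    by (rule hv_relators_vanish_on_span[where v = "padded_nth bs" and D = D,
          OF lin q(1) nz hv_scalar_relations[OF q(2) assms(6-8)]])
       (rule that(1) that(2)[unfolded W] T_mat_action[OF reps(1) _ q(1) len]
          U'_mat_action[OF reps(4) _ len] T'_mat_action[OF reps(2) lin _ D len]
          U_mat_action[OF reps(3) lin _ D len q(1)]; assumption?)+
  have W_sub: "fun_space.subspace W" and closed: "\<And>g f. f \<in> W \<Longrightarrow> G g f \<in> W"
    using represents_span_closed[OF lin rep] by (auto simp: assms(12))
  have "\<exists>act. algebra_module (HV k k' u ?q) (HV_const k k' u ?q) W act \<and>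
      (\<forall>g. \<forall>f\<in>W. act (HV_gen k k' u ?q g) f = G g f)"
    unfolding HV_def HV_const_def[abs_def] HV_gen_def HV_class_def hv_ideal_def
    by (rule algebra_module_quotient_exists[OF lin W_sub closed rel])
  then obtain act where act: "algebra_module (HV k k' u ?q) (HV_const k k' u ?q) W act"
    and act_gen: "\<forall>g. \<forall>f\<in>W. act (HV_gen k k' u ?q g) f = G g f"
    by (elim exE conjE) (rule that)
  have "bs ! j \<in> W" if "j < length bs" for j
    using that by (simp add: assms(12) fun_space.span_base)
  \<comment> \<open>The action of a generator agrees with \<open>G\<close> on \<open>W\<close>,
    which contains the basis vectors.\<close>
  then have "represents (M g) bs (act (HV_gen k k' u ?q g))" for g
    using rep[of g] by (simp add: represents_def act_gen)
  from this[of Gen_T] this[of Gen_T'] this[of Gen_U] this[of Gen_U'] show ?thesis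
    unfolding M_def hv_generator.case ordered_basis_def
    by (intro conjI exI[of _ act] basis act assms(12)[symmetric])
qed

end
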